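(* Let $\nu>0$, let $k\in\mathbb{Z}\setminus\{0\}$ be a fixed wavenumber, and let $\alpha=C_d/h_0^2$ for a constant $C_d>0$ and some fixed grid spacing $h_0>0$ (so $\alpha$ does not depend on $h$). Assume that $h\sqrt{s/\nu+k^2}\ll 1$. Then there exists a constant $h_c>0$ such that, for all $0<h<h_c$ and for $s\in\mathbb{C}$ with $\Re(s)>0$ (subject to the assumption $h\sqrt{s/\nu+k^2}\ll 1$), the determinant condition $$\det(Z)\neq 0$$ holds, where $Z=Z(s,h)$ is the $3\times 3$ matrix defined in the context.
   Context: For $h>0$ (the grid spacing) and $s\in\mathbb{C}$ with $\Re(s)>0$ define $$d_2^{(1)}=\frac{h^2(s+\nu k^2)}{\nu},\qquad d_2^{(2)},\,d_2^{(3)}=\frac{h^2(s+2\nu k^2+\alpha)\pm\sqrt{\left[(\alpha+s)^2+(s+\alpha+\nu k^2)\alpha h^2k^2\right]h^4}}{2(\nu-\alpha h^2/4)},$$ with the sign $+$ for $d_2^{(2)}$ and $-$ for $d_2^{(3)}$; the square root is taken so that, after division by $h^2$, it tends to $\alpha+s$ as $h\to0$ (the other choice only interchanges $d_2^{(2)}$ and $d_2^{(3)}$, which changes $\det(Z)$ only by a sign). For $n=1,2,3$ let $\lambda_{(n)}$ be the root with $|\lambda|<1$ of $\lambda^2-\left(2+d_2^{(n)}\right)\lambda+1=0$ (the two roots are reciprocal), and put $d_1^{(n)}=\left(\lambda_{(n)}-\lambda_{(n)}^{-1}\right)/2$. The matrix $Z$ is $$Z=\begin{pmatrix}-\dfrac{d_1^{(1)}}{h}&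 ik&\dfrac{ik}{\alpha}\\[2mm] ik&\dfrac{d_1^{(2)}}{h}&\dfrac{d_1^{(3)}}{h\alpha}\\[2mm] -\nu ik\dfrac{d_1^{(1)}(\lambda_{(1)}-1)}{h^2}&\left[-(s+2\nu k^2)+\nu\dfrac{d_2^{(2)}}{h^2}\right]\dfrac{\lambda_{(2)}-1}{h}&\left[-(s+2\nu k^2)+\nu\dfrac{d_2^{(3)}}{h^2}\right]\dfrac{\lambda_{(3)}-1}{h\alpha}\end{pmatrix}.$$ The hypothesis $h\sqrt{s/\nu+k^2}\ll 1$ is stated informally, without an explicit threshold; it restricts which $s$ are considered for a given $h$. Stability established under this assumption is called local stability: $\det(Z)\ne0$ means that the Laplace-transformed semi-discrete error problem (with dual variable $s$ and Fourier wavenumber $k$) whose boundary conditions give the linear system with matrix $Z$ has no eigenvalue $s$ with $\Re(s)>0$ in this regime. *)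

theory Defs
  imports "HOL-Analysis.Analysis"
begin

definition disc :: "real \<Rightarrow> real \<Rightarrow> int \<Rightarrow> complex \<Rightarrow> real \<Rightarrow> complex" where
  "disc \<nu> \<alpha> k s h =
     ((of_real \<alpha> + s)^2
        + (s + of_real \<alpha> + of_real \<nu> * of_int k ^ 2) * of_real \<alpha> * of_real h ^ 2 * of_int k ^ 2)
     * of_real h ^ 4"

text \<open>The principal square root of \<open>disc\<close> is the required branch; see
  \<open>csqrt_disc_tendsto\<close> below.\<close>

definition d2_1 :: "real \<Rightarrow> int \<Rightarrow> complex \<Rightarrow> real \<Rightarrow> complex" where
  "d2_1 \<nu> k s h = of_real h ^ 2 * (s + of_real \<nu> * of_int k ^ 2) / of_real \<nu>"

definition d2_2 :: "real \<Rightarrow> real \<Rightarrow> int \<Rightarrow> complex \<Rightarrow> real \<Rightarrow> complex" where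
  "d2_2 \<nu> \<alpha> k s h =
     (of_real h ^ 2 * (s + 2 * of_real \<nu> * of_int k ^ 2 + of_real \<alpha>) + csqrt (disc \<nu> \<alpha> k s h))
     / (2 * (of_real \<nu> - of_real \<alpha> * of_real h ^ 2 / 4))"

definition d2_3 :: "real \<Rightarrow> real \<Rightarrow> int \<Rightarrow> complex \<Rightarrow> real \<Rightarrow> complex" where
  "d2_3 \<nu> \<alpha> k s h =
     (of_real h ^ 2 * (s + 2 * of_real \<nu> * of_int k ^ 2 + of_real \<alpha>) - csqrt (disc \<nu> \<alpha> k s h))
     / (2 * (of_real \<nu> - of_real \<alpha> * of_real h ^ 2 / 4))"

definition is_lam :: "complex \<Rightarrow> complex \<Rightarrow> bool" where
  "is_lam d l \<longleftrightarrow> cmod l < 1 \<and> l^2 - (2 + d) * l + 1 = 0"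

text \<open>The description is proper only if a root inside the open unit disc exists, that is, if
  \<open>d\<close> does not lie in the real interval from \<open>-4\<close> to \<open>0\<close>; such a root is unique by
  \<open>is_lam_unique\<close>.\<close>

definition lam :: "complex \<Rightarrow> complex" where
  "lam d = (THE l. is_lam d l)"

definition d1 :: "complex \<Rightarrow> complex" where
  "d1 d = (lam d - inverse (lam d)) / 2"

definition Zmat :: "real \<Rightarrow> real \<Rightarrow> int \<Rightarrow> complex \<Rightarrow> real \<Rightarrow> complex^3^3" where
  "Zmat \<nu> \<alpha> k s h =
    (let H = complex_of_real h; N = complex_of_real \<nu>; A = complex_of_real \<alpha>;
         K = complex_of_int k;
         e1 = d2_1 \<nu> k s h; e2 = d2_2 \<nu> \<alpha> k s h; e3 = d2_3 \<nu> \<alpha> k s h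
     in vector
      [vector [- d1 e1 / H, \<i> * K, \<i> * K / A],
       vector [\<i> * K, d1 e2 / H, d1 e3 / (H * A)],
       vector [- N * \<i> * K * (d1 e1 * (lam e1 - 1) / H^2),
               (- (s + 2 * N * K^2) + N * (e2 / H^2)) * ((lam e2 - 1) / H),
               (- (s + 2 * N * K^2) + N * (e3 / H^2)) * ((lam e3 - 1) / (H * A))]])"

lemma is_lam_unique:
  assumes "is_lam d l" "is_lam d m"
  shows "l = m"
proof (rule ccontr)
  assume ne: "l \<noteq> m"
  have "l^2 - (2 + d) * l + 1 = 0" "m^2 - (2 + d) * m + 1 = 0"
    and lt: "cmod l < 1" "cmod m < 1"
    using assms by (auto simp: is_lam_def)
  then have "(l - m) * (l * m - 1) = 0" by algebra
  then have "l * m = 1" using ne by simp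
  then have "cmod l * cmod m = 1" by (metis norm_mult norm_one)
  moreover have "cmod l * cmod m < 1 * 1"
    by (rule mult_strict_mono) (use lt in auto)
  ultimately show False by simp
qed

lemma csqrt_disc_tendsto:
  assumes "\<alpha> > 0" "Re s > 0"
  shows "((\<lambda>h. csqrt (disc \<nu> \<alpha> k s h) / of_real h ^ 2) \<longlongrightarrow> of_real \<alpha> + s) (at_right 0)"
proof -
  define w :: "real \<Rightarrow> complex" where
    "w h = (of_real \<alpha> + s)^2
        + (s + of_real \<alpha> + of_real \<nu> * of_int k ^ 2) * of_real \<alpha> * of_real h ^ 2 * of_int k ^ 2" for h
  have root0: "csqrt ((of_real \<alpha> + s)^2) = of_real \<alpha> + s"
    by (rule csqrt_square) (use assms in simp)
  have np: "(of_real \<alpha> + s)^2 \<notin> \<real>\<^sub>\<le>\<^sub>0"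
  proof
    assume "(of_real \<alpha> + s)^2 \<in> \<real>\<^sub>\<le>\<^sub>0"
    then obtain r where r: "(of_real \<alpha> + s)^2 = of_real r" "r \<le> 0"
      by (auto elim: nonpos_Reals_cases)
    then have "Re (csqrt ((of_real \<alpha> + s)^2)) = 0" by simp
    then show False using root0 assms by simp
  qed
  have "(w \<longlongrightarrow> w 0) (at_right 0)"
    unfolding w_def by (intro tendsto_intros)
  then have "(w \<longlongrightarrow> (of_real \<alpha> + s)^2) (at_right 0)"
    by (simp add: w_def)
  then have lim: "((\<lambda>h. csqrt (w h)) \<longlongrightarrow> of_real \<alpha> + s) (at_right 0)"
    using isCont_tendsto_compose[OF continuous_at_csqrt[OF np]] root0 by metis
  have eq: "csqrt (disc \<nu> \<alpha> k s h) / of_real h ^ 2 = csqrt (w h)" if "h > 0" for h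
  proof -
    have "(of_real h ^ 2 * csqrt (w h))^2 = disc \<nu> \<alpha> k s h"
      by (simp add: power_mult_distrib w_def disc_def)
    moreover have "0 < Re (of_real h ^ 2 * csqrt (w h)) \<or>
        Re (of_real h ^ 2 * csqrt (w h)) = 0 \<and> 0 \<le> Im (of_real h ^ 2 * csqrt (w h))"
      using csqrt_principal[of "w h"] that
      by (auto simp: zero_less_mult_iff simp del: csqrt.simps simp flip: of_real_power)
    ultimately have "csqrt (disc \<nu> \<alpha> k s h) = of_real h ^ 2 * csqrt (w h)"
      using csqrt_unique by blast
    then show ?thesis using that by simp
  qed
  have "eventually (\<lambda>h. csqrt (disc \<nu> \<alpha> k s h) / of_real h ^ 2 = csqrt (w h)) (at_right 0)"
    using eq by (auto simp: eventually_at_right_less eventually_at_filter)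
  then show ?thesis using lim by (simp add: tendsto_cong)
qed

end

theory Submission
  imports Defs "HOL-Library.Landau_Symbols"
begin

text \<open>
  Write \<open>\<sigma> = s/\<nu>\<close>, \<open>A = \<alpha>/\<nu>\<close>, \<open>\<kappa> = \<bar>k\<bar>\<close>, \<open>q = \<sigma> + \<kappa>\<^sup>2\<close> and \<open>x\<^sub>n = d\<^sub>2\<^sup>n/h\<^sup>2\<close>. A grid mode
  with symbol \<open>x\<close> decays at the rate \<open>\<mu> = -d\<^sub>1/h = \<surd>(x + h\<^sup>2 x\<^sup>2/4)\<close>. For \<open>h = 0\<close> one has
  \<open>x\<^sub>1 = q\<close>, \<open>x\<^sub>2 = q + A\<close>, \<open>x\<^sub>3 = \<kappa>\<^sup>2\<close>, and the determinant is a constant multiple of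
  \<open>\<kappa> (\<sigma> + A) \<mu>\<^sub>2 (\<mu>\<^sub>1 - \<kappa>)\<close> with \<open>\<mu>\<^sub>1 = \<surd>q\<close>. Its only zero in the closed right half plane
  is \<open>\<sigma> = 0\<close>, which lies on the boundary. A bound \<open>O(h)\<close> on the perturbation caused by
  \<open>h > 0\<close> is therefore not enough: the zero might move into the open half plane.

  It moves to the left. For \<open>h > 0\<close> put \<open>\<theta> = \<mu>\<^sub>1 - \<kappa>\<close>. Then \<open>\<theta> (\<mu>\<^sub>1 + \<kappa>) = \<tau>\<close>, where
  \<open>\<tau> = \<sigma> + h\<^sup>2 q\<^sup>2/4\<close> is about \<open>\<sigma> + h\<^sup>2 \<kappa>\<^sup>4/4\<close> near the critical point. In the regime
  considered, \<open>\<bar>\<tau>\<bar>\<close> is bounded below by a constant multiple of \<open>\<bar>\<sigma>\<bar> + h\<^sup>2\<close>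
  (\<open>\<tau>_lower\<close>). The determinant, up to a constant factor, equals
  \<open>-\<kappa> (\<sigma> + A) \<mu>\<^sub>2 \<theta>\<close> plus a remainder, and the modulus of this leading term is at least a constant
  multiple of \<open>\<bar>q \<tau>\<bar>\<close> (\<open>q\<tau>_le_main\<close>). An exact rearrangement (\<open>modal_det_expansion_identity\<close>) writes the
  remainder as a sum of products each of which contains a factor of order \<open>\<tau>\<close>, and this gives
  the bound \<open>O(h q \<tau>)\<close> (\<open>modal_det_asymptotics\<close>). The delicate term is
  \<open>h\<^sup>2 q\<^sup>2/4 + (x\<^sub>3 - \<kappa>\<^sup>2)\<close>: each summand is only of order \<open>h\<^sup>2\<close> for bounded \<open>\<sigma>\<close>, but
  the quadratic equation for \<open>x\<^sub>3\<close> makes the sum \<open>O(h\<^sup>2 q \<tau>)\<close> (\<open>y_cancellation\<close>). So the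
  leading term dominates as soon as \<open>h\<close> is small.

  Uniformity in \<open>s\<close> is expressed by a filter on pairs \<open>(h, s)\<close> along which only \<open>h\<close> is
  forced to converge, so that the constants hidden in Landau symbols along it do not depend on
  \<open>s\<close>. The resolution hypothesis enters as \<open>\<bar>h\<^sup>2 q\<bar> \<le> 1/4\<close>, so the threshold \<open>\<epsilon> = 1/2\<close>
  works for all parameters.
\<close>

section \<open>Complex square roots\<close>

lemma csqrt_pos_scale:
  assumes "c > 0"
  shows "csqrt (of_real c ^ 2 * z) = of_real c * csqrt z"
proof (rule csqrt_unique)
  show "(of_real c * csqrt z)^2 = of_real c ^ 2 * z" by (simp add: power_mult_distrib)
  show "0 < Re (of_real c * csqrt z) \<or> Re (of_real c * csqrt z) = 0 \<and> 0 \<le> Im (of_real c * csqrt z)"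
    using csqrt_principal[of z] assms by (auto simp: zero_less_mult_iff simp del: csqrt.simps)
qed

text \<open>Let \<open>r\<close> be the root. From \<open>(r - a)(r + a) = e\<close> and \<open>Re r \<ge> 0\<close> one first gets the crude bound
  \<open>\<bar>r - a\<bar> \<le> \<bar>a\<bar>\<close>, hence \<open>\<bar>r + a\<bar> \<ge> \<bar>a\<bar>\<close>, and the second use of the product gives the claim.
  Only a lower bound on \<open>Re a\<close> enters, so the branch is under control even when \<open>a\<close> is large and
  nearly imaginary and the direction of \<open>a\<^sup>2\<close> is close to the branch cut.\<close>

lemma csqrt_square_perturbation:
  assumes a: "0 < Re a" and e: "cmod e \<le> \<delta> * cmod a" and \<delta>: "\<delta> \<le> Re a"
  shows "cmod (csqrt (a^2 + e) - a) \<le> \<delta>"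
proof -
  define r where "r = csqrt (a^2 + e)"
  have prod: "(r - a) * (r + a) = e"
    by (simp add: r_def algebra_simps flip: power2_eq_square)
  have "Re r \<ge> 0" using csqrt_principal[of "a^2+e"] unfolding r_def by linarith
  then have "Re a \<le> cmod (r + a)" using complex_Re_le_cmod[of "r + a"] by simp
  have pos: "cmod a > 0" using a by auto
  have nprod: "cmod (r - a) * cmod (r + a) \<le> \<delta> * cmod a"
    using e prod by (metis norm_mult)
  then have "cmod (r - a) * Re a \<le> Re a * cmod a"
    by (smt (verit) \<open>Re a \<le> cmod (r + a)\<close> \<delta> mult_left_mono mult_right_mono norm_ge_zero)
  then have "cmod (r - a) \<le> cmod a" using a by (simp add: mult.commute)
  moreover have "2 * cmod a \<le> cmod (r + a) + cmod (r - a)"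
    using norm_triangle_ineq4[of "r + a" "r - a"] by (simp add: norm_mult flip: mult_2)
  ultimately have "cmod a \<le> cmod (r + a)" by simp
  then have "cmod (r - a) * cmod a \<le> \<delta> * cmod a"
    using nprod by (smt (verit) mult_left_mono norm_ge_zero)
  then show ?thesis using pos by (simp add: r_def)
qed

section \<open>The decaying grid modes\<close>

text \<open>The roots multiply to \<open>1\<close>, so one of them is inside the unit disc unless both have modulus
  \<open>1\<close>; in that case the real part of their sum \<open>2 + d\<close> would be at most \<open>2\<close>.\<close>

lemma ex_is_lam:
  assumes "Re d > 0"
  shows "\<exists>l. is_lam d l"
proof -
  define r where "r = csqrt ((2 + d)^2 - 4)"
  define l where "l = (2 + d + r) / 2"
  define l' where "l' = (2 + d - r) / 2"
  have r2: "r^2 = (2 + d)^2 - 4" by (simp add: r_def)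
  have root: "l^2 - (2 + d) * l + 1 = 0" "l'^2 - (2 + d) * l' + 1 = 0" and prod: "l * l' = 1" and sum: "l + l' = 2 + d"
    using r2 unfolding l_def l'_def by (simp_all add: field_simps power2_eq_square)
  have nprod: "cmod l * cmod l' = 1" using prod by (metis norm_mult norm_one)
  have "cmod l \<noteq> 1"
  proof
    assume "cmod l = 1"
    then have "cmod l' = 1" using nprod by simp
    have "Re (2 + d) \<le> 2"
      using \<open>cmod l = 1\<close> \<open>cmod l' = 1\<close> complex_Re_le_cmod[of l] complex_Re_le_cmod[of l'] 
      unfolding sum[symmetric] by simp
    then show False using assms by simp
  qed
  then have "cmod l < 1 \<or> cmod l' < 1"
    using nprod by (smt (verit) mult_le_cancel_left1 mult_less_cancel_left1 norm_ge_zero)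
  then show ?thesis using root by (auto simp: is_lam_def)
qed

text \<open>The symbol of the negative central difference quotient on the mode \<open>\<lambda>\<^sup>j\<close>, that is
  \<open>(\<lambda>\<^sup>-\<^sup>1 - \<lambda>)/(2h)\<close>, for \<open>\<lambda> + \<lambda>\<^sup>-\<^sup>1 - 2 = h\<^sup>2 x\<close>. It tends to \<open>\<surd>x\<close> as \<open>h \<rightarrow> 0\<close>.\<close>

definition central_rate :: "real \<Rightarrow> complex \<Rightarrow> complex"
  where "central_rate h x = csqrt (x + of_real h ^ 2 * x ^ 2 / 4)"

text \<open>Both \<open>\<plusminus>d1\<close> are square roots of \<open>d + d\<^sup>2/4\<close>. The principal one is \<open>-d1\<close>: positivity of
  \<open>Re (\<lambda> + \<lambda>\<^sup>-\<^sup>1)\<close> forces \<open>Re \<lambda> > 0\<close>, and then \<open>\<bar>\<lambda>\<bar> < 1\<close> makes \<open>Re \<lambda>\<^sup>-\<^sup>1\<close> exceed \<open>Re \<lambda>\<close>.\<close>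

lemma lam_d1_eq:
  assumes h: "h > 0" and x: "Re x > 0"
  defines "d \<equiv> of_real h ^ 2 * x"
  shows "d1 d = - of_real h * central_rate h x"
    and "lam d = 1 + d / 2 + d1 d"
proof -
  have Red: "Re d > 0" using assms by (simp add: d_def flip: of_real_power)
  then obtain l where l: "is_lam d l" using ex_is_lam by blast
  have lam: "lam d = l" unfolding lam_def using l is_lam_unique by blast
  have lt: "cmod l < 1" and eq: "l^2 - (2 + d) * l + 1 = 0" using l by (auto simp: is_lam_def)
  then have nz: "l \<noteq> 0" by auto
  have sum: "l + inverse l = 2 + d"
    using eq nz by (simp add: field_simps power2_eq_square)
  have "inverse l = 2 + d - l" using sum by (simp add: algebra_simps)
  then have "d1 d = (l - (2 + d - l)) / 2" unfolding d1_def lam by simp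
  then show "lam d = 1 + d / 2 + d1 d" unfolding lam by (simp add: diff_divide_distrib add_divide_distrib)
  have sq: "(- d1 d)^2 = of_real h ^ 2 * (x + of_real h ^ 2 * x^2 / 4)"
  proof -
    have "4 * (d1 d)^2 = (l + inverse l)^2 - 4"
      using nz unfolding d1_def lam by (simp add: field_simps power2_eq_square)
    also have "\<dots> = 4 * d + d^2" unfolding sum by (simp add: power2_eq_square algebra_simps)
    finally have "(- d1 d)^2 = d + d^2 / 4" by (simp add: field_simps)
    then show ?thesis unfolding d_def by (simp add: power2_eq_square algebra_simps)
  qed
  have Reinv: "Re (inverse l) = Re l / (cmod l)^2"
    unfolding cmod_power2 inverse_complex.simps ..
  have n2: "0 < (cmod l)^2" "(cmod l)^2 < 1" using nz lt by (simp_all add: power_less_one_iff abs_square_less_1)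
  have "Re l * (1 + 1 / (cmod l)^2) = Re (2 + d)"
    unfolding sum[symmetric] plus_complex.sel Reinv by (simp add: algebra_simps)
  then have "Re l * (1 + 1 / (cmod l)^2) > 0" using Red by simp
  then have "Re l > 0"
    using n2 by (metis add_pos_pos zero_less_divide_1_iff zero_less_mult_pos2 zero_less_one)
  then have "Re l < Re l / (cmod l)^2" using n2 by (simp add: field_simps)
  then have "Re (- d1 d) > 0" unfolding d1_def lam using Reinv by (simp del: inverse_complex.simps)
  then have "- d1 d = csqrt (of_real h ^ 2 * (x + of_real h ^ 2 * x^2 / 4))"
    using csqrt_unique[OF sq] by simp
  then show "d1 d = - of_real h * central_rate h x"
    unfolding csqrt_pos_scale[OF h] central_rate_def by (metis minus_equation_iff minus_mult_left)
qed

text \<open>The square is \<open>x (1 + h\<^sup>2 x/4)\<close>, and the second factor has real part at least \<open>1\<close>.\<close>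

lemma norm_le_central_rate_sq:
  assumes "Re x \<ge> 0"
  shows "cmod x \<le> (cmod (central_rate h x))^2"
proof -
  have "1 \<le> Re (1 + of_real h ^ 2 * x / 4)" using assms by (simp flip: of_real_power)
  then have "1 \<le> cmod (1 + of_real h ^ 2 * x / 4)"
    using complex_Re_le_cmod[of "1 + of_real h ^ 2 * x / 4"] by linarith
  then have "cmod x * 1 \<le> cmod x * cmod (1 + of_real h ^ 2 * x / 4)"
    by (intro mult_left_mono) simp_all
  also have "\<dots> = cmod (central_rate h x ^ 2)"
    unfolding central_rate_def power2_csqrt norm_mult[symmetric]
    by (simp add: power2_eq_square algebra_simps)
  finally show ?thesis by (simp add: norm_power)
qed

section \<open>The determinant in rescaled variables\<close>

text \<open>The square root in the formula for \<open>d2_2\<close> and \<open>d2_3\<close>, divided by \<open>\<nu> h\<^sup>2\<close>, in terms of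
  \<open>A = \<alpha>/\<nu>\<close>, \<open>\<kappa> = \<bar>k\<bar>\<close> and \<open>\<sigma> = s/\<nu>\<close>. For small \<open>h\<close> it is close to \<open>\<sigma> + A\<close>, so \<open>x_plus\<close> below is close to
  \<open>\<sigma> + \<kappa>\<^sup>2 + A\<close> and \<open>x_minus\<close> to \<open>\<kappa>\<^sup>2\<close>.\<close>

definition disc_root :: "real \<Rightarrow> real \<Rightarrow> real \<Rightarrow> complex \<Rightarrow> complex"
  where "disc_root A \<kappa> h \<sigma> = csqrt ((\<sigma> + A)^2 + (\<sigma> + A + \<kappa>^2) * A * h^2 * \<kappa>^2)"

definition x_plus :: "real \<Rightarrow> real \<Rightarrow> real \<Rightarrow> complex \<Rightarrow> complex"
  where "x_plus A \<kappa> h \<sigma> = (\<sigma> + 2 * \<kappa>^2 + A + disc_root A \<kappa> h \<sigma>) / (2 * (1 - A * h^2 / 4))"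

definition x_minus :: "real \<Rightarrow> real \<Rightarrow> real \<Rightarrow> complex \<Rightarrow> complex"
  where "x_minus A \<kappa> h \<sigma> = (\<sigma> + 2 * \<kappa>^2 + A - disc_root A \<kappa> h \<sigma>) / (2 * (1 - A * h^2 / 4))"

text \<open>The forward difference counterpart \<open>(1 - \<lambda>)/h\<close> of \<open>central_rate\<close>.\<close>

definition forward_rate :: "real \<Rightarrow> complex \<Rightarrow> complex"
  where "forward_rate h x = central_rate h x - h * x / 2"

text \<open>The determinant of \<open>Z\<close>, multiplied by \<open>\<alpha>/\<nu>\<close>, for modes with symbols \<open>x1\<close>, \<open>x2\<close>, \<open>x3\<close>. The factors
  \<open>x3 - x1 - \<kappa>\<^sup>2\<close> and \<open>x2 - x1 - \<kappa>\<^sup>2\<close> are the square brackets of the third row divided by \<open>\<nu>\<close>.\<close>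

definition modal_det :: "real \<Rightarrow> real \<Rightarrow> complex \<Rightarrow> complex \<Rightarrow> complex \<Rightarrow> complex"
  where "modal_det h \<kappa> x1 x2 x3 =
    (x3 - x1 - \<kappa>^2) * forward_rate h x3 * (central_rate h x1 * central_rate h x2 - \<kappa>^2)
    - (x2 - x1 - \<kappa>^2) * forward_rate h x2 * (central_rate h x1 * central_rate h x3 - \<kappa>^2)
    + \<kappa>^2 * central_rate h x1 * forward_rate h x1 * (central_rate h x2 - central_rate h x3)"

lemma of_real_abs_of_int_sq: "(complex_of_real \<bar>of_int k\<bar>)^2 = of_int k^2"
  by (metis of_real_of_int_eq of_real_power power2_abs)

lemma csqrt_disc_eq:
  fixes \<nu> \<alpha> h :: real and k :: int and s :: complex
  assumes "\<nu> > 0" "h > 0"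
  shows "csqrt (disc \<nu> \<alpha> k s h) = \<nu> * h^2 * disc_root (\<alpha> / \<nu>) \<bar>of_int k\<bar> h (s / \<nu>)"
proof -
  have eq: "disc \<nu> \<alpha> k s h = of_real (\<nu> * h^2) ^ 2 * ((s / \<nu> + of_real (\<alpha> / \<nu>))^2
      + (s / \<nu> + of_real (\<alpha> / \<nu>) + of_real \<bar>of_int k\<bar>^2) * of_real (\<alpha> / \<nu>) * of_real h^2 * of_real \<bar>of_int k\<bar>^2)"
    unfolding of_real_abs_of_int_sq
    using assms by (simp add: disc_def field_simps power2_eq_square eval_nat_numeral)
  have pos: "\<nu> * h^2 > 0" using assms by simp
  show ?thesis
    unfolding eq csqrt_pos_scale[OF pos] disc_root_def by (simp only: of_real_mult of_real_power)
qed

lemma d2_eq: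
  fixes \<nu> \<alpha> h :: real and k :: int and s :: complex
  assumes "\<nu> > 0" "h > 0"
  shows "d2_1 \<nu> k s h = h^2 * (s / \<nu> + of_real \<bar>of_int k\<bar>^2)"
    and "d2_2 \<nu> \<alpha> k s h = h^2 * x_plus (\<alpha> / \<nu>) \<bar>of_int k\<bar> h (s / \<nu>)"
    and "d2_3 \<nu> \<alpha> k s h = h^2 * x_minus (\<alpha> / \<nu>) \<bar>of_int k\<bar> h (s / \<nu>)"
proof -
  have scale: "2 * (of_real \<nu> - of_real \<alpha> * of_real h^2 / 4) =
      of_real \<nu> * (2 * (1 - of_real (\<alpha> / \<nu>) * of_real h^2 / 4 :: complex))"
    using assms by (simp add: field_simps)
  have num: "of_real h^2 * (s + 2 * of_real \<nu> * of_int k^2 + of_real \<alpha>) =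
      of_real \<nu> * (of_real h^2 * (s / of_real \<nu> + 2 * of_real \<bar>of_int k\<bar>^2 + of_real (\<alpha> / \<nu>)))"
    unfolding of_real_abs_of_int_sq using assms by (simp add: field_simps)
  have canc: "(of_real \<nu> * a + of_real \<nu> * of_real h^2 * r) / (of_real \<nu> * b) = (a + of_real h^2 * r) / b"
    "(of_real \<nu> * a - of_real \<nu> * of_real h^2 * r) / (of_real \<nu> * b) = (a - of_real h^2 * r) / b" for a b r :: complex
    using assms by (simp_all only: mult.assoc flip: distrib_left right_diff_distrib) simp_all
  show "d2_1 \<nu> k s h = h^2 * (s / \<nu> + of_real \<bar>of_int k\<bar>^2)"
    unfolding of_real_add of_real_power of_real_abs_of_int_sq
    using assms by (simp add: d2_1_def field_simps)
  show "d2_2 \<nu> \<alpha> k s h = h^2 * x_plus (\<alpha> / \<nu>) \<bar>of_int k\<bar> h (s / \<nu>)"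
    unfolding d2_2_def csqrt_disc_eq[OF assms] scale num of_real_mult of_real_power canc x_plus_def
    by (simp add: algebra_simps)
  show "d2_3 \<nu> \<alpha> k s h = h^2 * x_minus (\<alpha> / \<nu>) \<bar>of_int k\<bar> h (s / \<nu>)"
    unfolding d2_3_def csqrt_disc_eq[OF assms] scale num of_real_mult of_real_power canc x_minus_def
    by (simp add: algebra_simps)
qed

text \<open>Positivity of the real parts ensures that the three decaying roots exist.\<close>

lemma det_Zmat_eq:
  fixes \<nu> \<alpha> h :: real and k :: int and s :: complex
  defines "\<kappa> \<equiv> \<bar>of_int k\<bar> :: real"
  defines "x1 \<equiv> s / \<nu> + \<kappa>^2" and "x2 \<equiv> x_plus (\<alpha> / \<nu>) \<kappa> h (s / \<nu>)" and "x3 \<equiv> x_minus (\<alpha> / \<nu>) \<kappa> h (s / \<nu>)"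
  assumes "\<nu> > 0" "\<alpha> > 0" "h > 0" and Re: "Re x1 > 0" "Re x2 > 0" "Re x3 > 0"
  shows "\<alpha> * det (Zmat \<nu> \<alpha> k s h) = \<nu> * modal_det h \<kappa> x1 x2 x3"
proof -
  define K where "K = complex_of_int k"
  define H where "H = complex_of_real h"
  define N where "N = complex_of_real \<nu>"
  define C where "C = complex_of_real \<alpha>"
  have nz: "H \<noteq> 0" "N \<noteq> 0" "C \<noteq> 0" using assms by (simp_all add: H_def N_def C_def)
  have K2: "of_real \<kappa>^2 = K^2" unfolding \<kappa>_def K_def by (rule of_real_abs_of_int_sq)
  have s: "s = N * (x1 - K^2)" using nz by (simp add: x1_def K2 N_def)
  have d1: "d1 (H^2 * x) = - H * central_rate h x" and lam1: "lam (H^2 * x) - 1 = - H * forward_rate h x" if "Re x > 0" for x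
    using lam_d1_eq[OF \<open>h > 0\<close> that] by (simp_all add: H_def forward_rate_def algebra_simps power2_eq_square)
  have e: "d2_1 \<nu> k s h = H^2 * x1" "d2_2 \<nu> \<alpha> k s h = H^2 * x2" "d2_3 \<nu> \<alpha> k s h = H^2 * x3"
    using d2_eq[OF \<open>\<nu> > 0\<close> \<open>h > 0\<close>] by (simp_all add: H_def x1_def x2_def x3_def \<kappa>_def)
  have bracket: "- (N * (x1 - K^2) + 2 * N * K^2) + N * (H^2 * x / H^2) = N * (x - x1 - K^2)" for x
    using nz by (simp add: algebra_simps)
  have Z: "Zmat \<nu> \<alpha> k s h = vector
      [vector [central_rate h x1, \<i> * K, \<i> * K / C],
       vector [\<i> * K, - central_rate h x2, - central_rate h x3 / C],
       vector [- N * \<i> * K * (central_rate h x1 * forward_rate h x1),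
               - (N * (x2 - x1 - K^2)) * forward_rate h x2,
               - (N * (x3 - x1 - K^2)) * forward_rate h x3 / C]]"
    unfolding Zmat_def Let_def e d1[OF Re(1)] d1[OF Re(2)] d1[OF Re(3)] lam1[OF Re(1)] lam1[OF Re(2)] lam1[OF Re(3)]
    unfolding s H_def[symmetric] N_def[symmetric] K_def[symmetric] C_def[symmetric] bracket
    using nz by (simp add: power2_eq_square)
  show ?thesis
    unfolding Z det_3 modal_det_def K2 N_def[symmetric] C_def[symmetric]
    using nz by (simp add: vector_3 field_simps power2_eq_square)
qed

section \<open>Exact algebraic identities\<close>

text \<open>In this factored form the quadratic equation of \<open>x\<^sub>2\<close> and \<open>x\<^sub>3\<close> shows its two
  unperturbed roots \<open>\<kappa>\<^sup>2\<close> and \<open>\<kappa>\<^sup>2 + \<sigma> + A\<close>.\<close>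

lemma x_minus_quadratic:
  fixes A \<kappa> h :: real and \<sigma> x :: complex
  defines "x \<equiv> x_minus A \<kappa> h \<sigma>"
  assumes "A * h^2 \<noteq> 4"
  shows "(x - \<kappa>^2) * (x - \<kappa>^2 - \<sigma> - A) = A * h^2 * x^2 / 4"
proof -
  define c where "c = complex_of_real (A * h^2 / 4)"
  define r where "r = disc_root A \<kappa> h \<sigma>"
  define B where "B = \<sigma> + 2 * of_real \<kappa>^2 + of_real A"
  define m where "m = complex_of_real \<kappa>^2"
  have c1: "1 - c \<noteq> 0"
    using assms by (simp add: c_def) (metis of_real_eq_iff of_real_mult of_real_numeral of_real_power)
  have x: "2 * (1 - c) * x = B - r"
    using c1 by (simp add: x_def x_minus_def c_def B_def r_def)
  have r2: "r^2 = B^2 - 4 * (1 - c) * m * (\<sigma> + A + m)"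
    unfolding r_def disc_root_def power2_csqrt B_def m_def c_def
    by (simp add: power2_eq_square algebra_simps)
  \<comment> \<open>completing the square\<close>
  have "4 * (1 - c) * ((1 - c) * x^2 - B * x + m * (\<sigma> + A + m)) = 0"
    using x r2 by algebra
  then have "(1 - c) * x^2 - B * x + m * (\<sigma> + A + m) = 0" using c1 by simp
  then show ?thesis
    by (simp add: B_def m_def c_def power2_eq_square algebra_simps)
qed

text \<open>Here \<open>a\<close>, \<open>b\<close>, \<open>c\<close> stand for \<open>\<mu>\<^sub>1\<close>, \<open>\<mu>\<^sub>2\<close>, \<open>\<mu>\<^sub>3\<close>. The left side is \<open>modal_det\<close> minus its leading
  term. The right side is arranged so that, after expanding the coefficient of \<open>b - \<kappa>\<close>, every
  summand contains \<open>\<theta>\<close> or \<open>\<sigma> - y\<close>, which are \<open>O(\<tau>)\<close>, next to a quantity that is small with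
  \<open>h\<close>, or else \<open>\<phi>\<close> or \<open>h\<^sup>2 q\<^sup>2/4 + y\<close>, which carry both \<open>h\<^sup>2\<close> and \<open>\<tau>\<close>. This coefficient is the place where
  terms of order \<open>\<tau>\<close> without a factor \<open>h\<close> cancel, through \<open>\<theta> (a + \<kappa>) = \<sigma> + h\<^sup>2 q\<^sup>2/4\<close>.\<close>

lemma modal_det_expansion_identity:
  fixes \<kappa> A q x2 x3 a b c p1 p2 p3 h :: complex
  defines "\<theta> \<equiv> a - \<kappa>" and "\<phi> \<equiv> c - \<kappa>" and "y \<equiv> x3 - \<kappa>^2" and "\<sigma> \<equiv> q - \<kappa>^2"
  assumes a2: "a^2 = q + h^2 * q^2 / 4"
    and p1: "p1 = a - h * q / 2" and p2: "p2 = b - h * x2 / 2" and p3: "p3 = c - h * x3 / 2"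
  shows "(x3 - q - \<kappa>^2) * p3 * (a * b - \<kappa>^2) - (x2 - q - \<kappa>^2) * p2 * (a * c - \<kappa>^2)
        + \<kappa>^2 * a * p1 * (b - c)
      + \<kappa> * ((\<sigma> + A) * b * \<theta>) =
      \<kappa> * ((b - \<kappa>) * ((\<kappa> * ((h^2 * q^2 / 4 + y) - \<theta> * h * q / 2)) - \<kappa>^2 * \<phi> - (\<sigma> - y) * (\<phi> - h * y / 2)))
      + (\<theta> * b) * (y * \<kappa> + (y - q) * (p3 - \<kappa>))
      - \<kappa> * (\<theta> * ((x2 - q - A) * p2 - (A - \<kappa>^2) * (h * x2) / 2))
      - (x2 - q - \<kappa>^2) * p2 * \<phi> * a - \<kappa>^2 * (a * p1 * \<phi>)"
proof -
  have E: "(y - q) * p3 + \<kappa> * a * p1 = (\<kappa> * ((h^2 * q^2 / 4 + y) - \<theta> * h * q / 2)) - \<kappa>^2 * \<phi> - (\<sigma> - y) * (\<phi> - h * y / 2)"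
    using a2 unfolding p1 p3 \<theta>_def \<phi>_def y_def \<sigma>_def by algebra
  show ?thesis unfolding E[symmetric]
    unfolding p2 p3 \<theta>_def \<phi>_def y_def \<sigma>_def by algebra
qed

section \<open>Landau calculus\<close>

lemma bigo_absorb:
  fixes f g k :: "'a \<Rightarrow> complex"
  assumes "f \<in> O[F](\<lambda>z. g z * k z)" "g \<in> O[F](\<lambda>_. 1)"
  shows "f \<in> O[F](k)"
  using landau_o.big_trans[OF assms(1) landau_o.big.mult[OF assms(2) landau_o.big_refl]] by simp

lemma bigo_rearrange:
  fixes f g f' g' :: "'a \<Rightarrow> complex"
  assumes "f \<in> O[F](g)" "\<And>z. f z = f' z" "\<And>z. g z = g' z"
  shows "f' \<in> O[F](g')"
proof -
  have "f = f'" "g = g'" using assms(2,3) by auto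
  then show ?thesis using assms(1) by simp
qed

lemma bigo_cancel_right:
  fixes f g k :: "'a \<Rightarrow> complex"
  assumes "(\<lambda>z. f z * k z) \<in> O[F](\<lambda>z. g z * k z)" "\<forall>\<^sub>F z in F. k z \<noteq> 0"
  shows "f \<in> O[F](g)"
proof -
  obtain C where "\<forall>\<^sub>F z in F. cmod (f z * k z) \<le> C * cmod (g z * k z)"
    using assms(1) by (elim landau_o.bigE)
  then show ?thesis using assms(2)
    by (intro bigoI[where c = C], eventually_elim) (simp add: norm_mult flip: mult.assoc)
qed

section \<open>Uniform estimates as the spacing shrinks\<close>

text \<open>Points of the filter are thought of as pairs of a spacing and a spectral parameter. Only the
  spacing converges; \<open>\<sigma>\<close> ranges over the right half plane as far as the resolution condition
  \<open>\<bar>h\<^sup>2 (\<sigma> + \<kappa>\<^sup>2)\<bar> \<le> 1/4\<close> permits, so \<open>\<sigma>\<close> may tend to \<open>0\<close> or to infinity.\<close>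

locale shrinking_spacing =
  fixes A \<kappa> :: real and F :: "'a filter" and h :: "'a \<Rightarrow> real" and \<sigma> :: "'a \<Rightarrow> complex"
  assumes A_pos: "A > 0" and \<kappa>_pos: "\<kappa> > 0"
    and h_lim: "(h \<longlongrightarrow> 0) F"
    and h_pos: "\<forall>\<^sub>F z in F. h z > 0"
    and Re_\<sigma>: "\<forall>\<^sub>F z in F. Re (\<sigma> z) > 0"
    and resolved: "\<forall>\<^sub>F z in F. cmod (of_real (h z) ^ 2 * (\<sigma> z + \<kappa>^2)) \<le> 1 / 4"
begin

abbreviation H where "H z \<equiv> complex_of_real (h z)"

text \<open>All estimates are in terms of \<open>h\<close>, \<open>S\<close> and \<open>\<tau>\<close>. The function \<open>S = \<surd>q\<close> measures the
  rates \<open>\<mu>\<^sub>1\<close> and \<open>\<mu>\<^sub>2\<close>, while \<open>\<tau>\<close>, which is \<open>\<mu>\<^sub>1\<^sup>2 - \<kappa>\<^sup>2\<close>, measures the distance of the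
  spectral parameter from the zero near \<open>0\<close> of the leading term. The quantities
  \<open>\<rho>\<close>, \<open>y\<close> and \<open>\<phi>\<close> are the perturbations of the square root, of \<open>x3\<close> and of \<open>\<mu>3\<close>; they
  vanish for \<open>h = 0\<close>.\<close>

definition q where "q z = \<sigma> z + \<kappa>^2"
definition S where "S z = csqrt (q z)"
definition \<tau> where "\<tau> z = \<sigma> z + H z ^ 2 * q z ^ 2 / 4"
definition x2 where "x2 z = x_plus A \<kappa> (h z) (\<sigma> z)"
definition x3 where "x3 z = x_minus A \<kappa> (h z) (\<sigma> z)"
definition \<rho> where "\<rho> z = disc_root A \<kappa> (h z) (\<sigma> z) - (\<sigma> z + A)"
definition y where "y z = x3 z - \<kappa>^2"
definition \<mu>1 where "\<mu>1 z = central_rate (h z) (q z)"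
definition \<mu>2 where "\<mu>2 z = central_rate (h z) (x2 z)"
definition \<mu>3 where "\<mu>3 z = central_rate (h z) (x3 z)"
definition \<theta> where "\<theta> z = \<mu>1 z - \<kappa>"
definition \<phi> where "\<phi> z = \<mu>3 z - \<kappa>"
definition p1 where "p1 z = forward_rate (h z) (q z)"
definition p2 where "p2 z = forward_rate (h z) (x2 z)"
definition p3 where "p3 z = forward_rate (h z) (x3 z)"

lemma h2_small:
  assumes "\<delta> > 0"
  shows "\<forall>\<^sub>F z in F. h z ^ 2 < \<delta>"
proof -
  have "((\<lambda>z. h z ^ 2) \<longlongrightarrow> 0 ^ 2) F" by (intro tendsto_intros h_lim)
  then show ?thesis using assms by (simp add: order_tendsto_iff)
qed

lemma H_bound: "H \<in> O[F](\<lambda>_. 1)"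
proof -
  have "((\<lambda>z. H z) \<longlongrightarrow> of_real 0) F" by (intro tendsto_intros h_lim)
  then show ?thesis by (intro bigoI_tendsto[where c = 0]) simp_all
qed

lemma S2: "S z * S z = q z"
  by (simp add: S_def flip: power2_eq_square)

lemma Re_q: "\<forall>\<^sub>F z in F. Re (q z) > \<kappa>^2"
  using Re_\<sigma> by eventually_elim (simp add: q_def flip: of_real_power)

lemma one_le_S: "(\<lambda>_. 1) \<in> O[F](S)"
proof (rule bigoI[where c = "1 / \<kappa>"])
  show "\<forall>\<^sub>F z in F. cmod 1 \<le> 1 / \<kappa> * cmod (S z)"
    using Re_q
  proof eventually_elim
    case (elim z)
    then have "\<kappa>^2 \<le> cmod (q z)" using complex_Re_le_cmod[of "q z"] by linarith
    then have "\<kappa> \<le> cmod (S z)" by (simp add: S_def real_le_rsqrt)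
    then show ?case using \<kappa>_pos by (simp add: field_simps)
  qed
qed

lemma HS_bound: "(\<lambda>z. H z * S z) \<in> O[F](\<lambda>_. 1)"
proof (rule bigoI[where c = 1])
  show "\<forall>\<^sub>F z in F. cmod (H z * S z) \<le> 1 * cmod 1"
    using resolved
  proof eventually_elim
    case (elim z)
    have "(cmod (H z * S z))^2 = cmod (H z ^ 2 * (S z * S z))"
      by (simp add: norm_mult power2_eq_square)
    also have "\<dots> \<le> 1 ^ 2" using elim by (simp add: S2 q_def)
    finally show ?case by (simp only: power2_le_iff_abs_le norm_one abs_norm_cancel)
  qed
qed

text \<open>This is where the zero near \<open>\<sigma> = 0\<close> is seen to stay out of the right half plane.
  Expanding the square, \<open>\<tau> = (\<sigma> + d) + \<sigma> w\<close> with \<open>d = h\<^sup>2 \<kappa>\<^sup>4/4 > 0\<close> and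
  \<open>w = (h\<^sup>2 \<kappa>\<^sup>2 + h\<^sup>2 q)/4\<close>. For \<open>Re \<sigma> > 0\<close> there is no cancellation in \<open>\<sigma> + d\<close>, whose modulus is
  at least \<open>\<bar>\<sigma>\<bar>\<close> and at least \<open>d\<close>; the resolution condition gives \<open>\<bar>w\<bar> \<le> 1/4\<close>.\<close>

lemma \<tau>_lower: "\<forall>\<^sub>F z in F. cmod (\<sigma> z) \<le> 2 * cmod (\<tau> z) \<and> h z ^ 2 * \<kappa>^4 / 4 \<le> 2 * cmod (\<tau> z)"
proof -
  have "\<forall>\<^sub>F z in F. h z ^ 2 < 1 / (2 * \<kappa>^2)" using h2_small \<kappa>_pos by simp
  then show ?thesis using Re_\<sigma> resolved
  proof eventually_elim
    case (elim z)
    define w where "w = (H z ^ 2 * of_real (\<kappa>^2) + H z ^ 2 * q z) / 4"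
    define d where "d = h z ^ 2 * \<kappa>^4 / 4"
    have "d \<ge> 0" by (simp add: d_def)
    have \<tau>: "\<tau> z = (\<sigma> z + of_real d) + \<sigma> z * w"
      by (simp add: \<tau>_def w_def d_def q_def power2_eq_square eval_nat_numeral algebra_simps)
    have "cmod (H z ^ 2 * of_real (\<kappa>^2)) \<le> 1 / 2"
      using elim(1) \<kappa>_pos by (simp add: norm_mult norm_power field_simps)
    then have "cmod w \<le> 1 / 4"
      using elim(3) norm_triangle_ineq[of "H z ^ 2 * of_real (\<kappa>^2)" "H z ^ 2 * q z"]
      by (simp add: w_def q_def norm_divide)
    then have w: "cmod (\<sigma> z * w) \<le> cmod (\<sigma> z) / 4"
      unfolding norm_mult by (metis mult_left_mono norm_ge_zero times_divide_eq_right mult.right_neutral)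
    have t: "cmod (\<sigma> z + of_real d) \<le> cmod (\<tau> z) + cmod (\<sigma> z * w)"
      unfolding \<tau> by (metis norm_triangle_ineq4 add_diff_cancel_right')
    have "cmod (\<sigma> z) \<le> cmod (\<sigma> z + of_real d)"
      using elim(2) \<open>d \<ge> 0\<close> by (simp add: cmod_def power_mono)
    moreover have "d \<le> cmod (\<sigma> z + of_real d)"
      using complex_Re_le_cmod[of "\<sigma> z + of_real d"] elim(2) by simp
    ultimately show ?case using w t \<open>d \<ge> 0\<close> unfolding d_def[symmetric] by linarith
  qed
qed

lemma \<sigma>_le_\<tau>: "\<sigma> \<in> O[F](\<tau>)"
  using \<tau>_lower by (intro bigoI[where c = 2]) (auto elim: eventually_mono)

lemma H2_le_\<tau>: "(\<lambda>z. H z ^ 2) \<in> O[F](\<tau>)"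
  using \<tau>_lower \<kappa>_pos
  by (intro bigoI[where c = "8 / \<kappa>^4"]) (auto elim!: eventually_mono simp: norm_power field_simps)

text \<open>The perturbation under the root is \<open>O(h\<^sup>2) (\<sigma> + A + \<kappa>\<^sup>2)\<close>, which grows like \<open>\<sigma> + A\<close> itself,
  so the root moves by \<open>O(h\<^sup>2)\<close> uniformly in \<open>\<sigma>\<close>.\<close>

lemma \<rho>_bound: "\<forall>\<^sub>F z in F. cmod (\<rho> z) \<le> \<kappa>^2 * (A + \<kappa>^2) * h z ^ 2"
proof -
  define C where "C = \<kappa>^2 * (A + \<kappa>^2)"
  have C: "C > 0" using A_pos \<kappa>_pos by (simp add: C_def add_pos_pos)
  then have "\<forall>\<^sub>F z in F. h z ^ 2 < A / C" using h2_small A_pos by simp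
  then show ?thesis using Re_\<sigma> unfolding C_def[symmetric]
  proof eventually_elim
    case (elim z)
    let ?s = "\<sigma> z + A"
    have Re: "A \<le> Re ?s" using elim by simp
    then have nA: "A \<le> cmod ?s" using complex_Re_le_cmod[of ?s] by linarith
    have "A * cmod (?s + of_real (\<kappa>^2)) \<le> A * (cmod ?s + \<kappa>^2)"
      using norm_triangle_ineq[of ?s "of_real (\<kappa>^2)"] A_pos by (simp add: norm_power)
    also have "\<dots> \<le> (A + \<kappa>^2) * cmod ?s" using mult_left_mono[OF nA, of "\<kappa>^2"] by (simp add: algebra_simps)
    finally have n: "A * cmod (?s + of_real (\<kappa>^2)) \<le> (A + \<kappa>^2) * cmod ?s" .
    have "cmod ((?s + \<kappa>^2) * A * H z ^ 2 * \<kappa>^2) = h z ^ 2 * \<kappa>^2 * (A * cmod (?s + of_real (\<kappa>^2)))"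
      using A_pos by (simp add: norm_mult norm_power)
    also have "\<dots> \<le> h z ^ 2 * \<kappa>^2 * ((A + \<kappa>^2) * cmod ?s)"
      by (intro mult_left_mono n) simp
    also have "\<dots> = C * h z ^ 2 * cmod ?s" by (simp add: C_def)
    finally have e: "cmod ((?s + \<kappa>^2) * A * H z ^ 2 * \<kappa>^2) \<le> C * h z ^ 2 * cmod ?s" .
    have "C * h z ^ 2 \<le> Re ?s" using elim(1) C Re by (simp add: field_simps)
    then have "cmod (csqrt (?s^2 + (?s + \<kappa>^2) * A * H z ^ 2 * \<kappa>^2) - ?s) \<le> C * h z ^ 2"
      using Re A_pos by (intro csqrt_square_perturbation[OF _ e]) linarith+
    then show ?case by (simp add: \<rho>_def disc_root_def)
  qed
qed

lemma \<rho>_bigo: "\<rho> \<in> O[F](\<lambda>z. H z ^ 2)"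
  using \<rho>_bound by (intro bigoI[where c = "\<kappa>^2 * (A + \<kappa>^2)"]) (simp add: norm_power)

lemma denom_ge: "\<forall>\<^sub>F z in F. 1 \<le> 2 * (1 - A * h z ^ 2 / 4)"
proof -
  have "\<forall>\<^sub>F z in F. h z ^ 2 < 2 / A" using h2_small A_pos by simp
  then show ?thesis by eventually_elim (use A_pos in \<open>simp add: field_simps\<close>)
qed

lemma x_mult_denom:
  "\<forall>\<^sub>F z in F. of_real (2 * (1 - A * h z ^ 2 / 4)) * x2 z = 2 * (q z + A) + \<rho> z \<and>
     of_real (2 * (1 - A * h z ^ 2 / 4)) * x3 z = 2 * \<kappa>^2 - \<rho> z"
  using denom_ge
proof eventually_elim
  case (elim z)
  define D where "D = 2 * (1 - A * h z ^ 2 / 4)"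
  have "x2 z = (\<sigma> z + 2 * \<kappa>^2 + A + disc_root A \<kappa> (h z) (\<sigma> z)) / of_real D"
    "x3 z = (\<sigma> z + 2 * \<kappa>^2 + A - disc_root A \<kappa> (h z) (\<sigma> z)) / of_real D"
    by (simp_all add: x2_def x3_def x_plus_def x_minus_def D_def)
  moreover have "D \<noteq> 0" using elim by (simp add: D_def)
  ultimately show ?case unfolding D_def[symmetric] by (simp add: \<rho>_def q_def)
qed

text \<open>The common denominator of \<open>x2\<close> and \<open>x3\<close> is eventually at least \<open>1\<close>, so estimates can be made
  before dividing by it.\<close>

lemma bigo_of_denom_mult:
  fixes f g :: "'a \<Rightarrow> complex"
  assumes "(\<lambda>z. of_real (2 * (1 - A * h z ^ 2 / 4)) * f z) \<in> O[F](g)"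
  shows "f \<in> O[F](g)"
proof (rule landau_o.big_trans[OF _ assms], rule bigoI[where c = 1])
  show "\<forall>\<^sub>F z in F. cmod (f z) \<le> 1 * cmod (of_real (2 * (1 - A * h z ^ 2 / 4)) * f z)"
    using denom_ge
  proof eventually_elim
    case (elim z)
    define D where "D = 2 * (1 - A * h z ^ 2 / 4)"
    have "1 * cmod (f z) \<le> D * cmod (f z)" using elim by (intro mult_right_mono) (simp_all add: D_def)
    then show ?case using elim unfolding D_def[symmetric] by (simp add: norm_mult)
  qed
qed

lemma y_bigo: "y \<in> O[F](\<lambda>z. H z ^ 2)"
proof (rule bigo_of_denom_mult)
  have "(\<lambda>z. (A * \<kappa>^2 / 2) * H z ^ 2 - \<rho> z) \<in> O[F](\<lambda>z. H z ^ 2)"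
    by (intro sum_in_bigo \<rho>_bigo) (simp add: A_pos)
  also have "?this \<longleftrightarrow> (\<lambda>z. of_real (2 * (1 - A * h z ^ 2 / 4)) * y z) \<in> O[F](\<lambda>z. H z ^ 2)"
  proof (rule landau_o.big.in_cong)
    show "\<forall>\<^sub>F z in F. (A * \<kappa>^2 / 2) * H z ^ 2 - \<rho> z = of_real (2 * (1 - A * h z ^ 2 / 4)) * y z"
      using x_mult_denom
    proof eventually_elim
      case (elim z)
      show ?case unfolding y_def right_diff_distrib[of _ "x3 z"] conjunct2[OF elim]
        by (simp add: algebra_simps)
    qed
  qed
  finally show "(\<lambda>z. of_real (2 * (1 - A * h z ^ 2 / 4)) * y z) \<in> O[F](\<lambda>z. H z ^ 2)" .
qed

lemma one_le_q: "(\<lambda>_. 1) \<in> O[F](q)"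
  using landau_o.big.mult[OF one_le_S one_le_S] by (simp add: S2)

lemma H2_bound: "(\<lambda>z. H z ^ 2) \<in> O[F](\<lambda>_. 1)"
  using landau_o.big.mult[OF H_bound H_bound] by (simp add: power2_eq_square)

lemma H2q_bound: "(\<lambda>z. H z ^ 2 * q z) \<in> O[F](\<lambda>_. 1)"
  using landau_o.big.mult[OF HS_bound HS_bound] by (simp add: S2[symmetric] power2_eq_square mult_ac)

lemma q_plus_A_bigo: "(\<lambda>z. q z + A) \<in> O[F](q)"
  using landau_o.big.cmult_in_iff[of "of_real A" "\<lambda>_. 1" F q] one_le_q A_pos
  by (intro sum_in_bigo) auto

lemma x2_near: "(\<lambda>z. x2 z - (q z + A)) \<in> O[F](\<lambda>z. H z ^ 2 * q z)"
proof (rule bigo_of_denom_mult)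
  have "(\<lambda>z. (A / 2) * (H z ^ 2 * (q z + A)) + \<rho> z) \<in> O[F](\<lambda>z. H z ^ 2 * q z)"
    using landau_o.big_mult_1[OF \<rho>_bigo one_le_q]
      landau_o.big.mult_left[OF q_plus_A_bigo, of "\<lambda>z. H z ^ 2"]
    by (intro sum_in_bigo) (simp_all add: A_pos)
  also have "?this \<longleftrightarrow> (\<lambda>z. of_real (2 * (1 - A * h z ^ 2 / 4)) * (x2 z - (q z + A))) \<in> O[F](\<lambda>z. H z ^ 2 * q z)"
  proof (rule landau_o.big.in_cong)
    show "\<forall>\<^sub>F z in F. (A / 2) * (H z ^ 2 * (q z + A)) + \<rho> z
        = of_real (2 * (1 - A * h z ^ 2 / 4)) * (x2 z - (q z + A))"
      using x_mult_denom
    proof eventually_elim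
      case (elim z)
      show ?case unfolding right_diff_distrib[of _ "x2 z"] conjunct1[OF elim]
        by (simp add: algebra_simps)
    qed
  qed
  finally show "(\<lambda>z. of_real (2 * (1 - A * h z ^ 2 / 4)) * (x2 z - (q z + A))) \<in> O[F](\<lambda>z. H z ^ 2 * q z)" .
qed

lemma x2_bigo: "x2 \<in> O[F](q)"
proof -
  have "(\<lambda>z. (x2 z - (q z + A)) + (q z + A)) \<in> O[F](q)"
    using landau_o.big.mult[OF H2_bound landau_o.big_refl[of q]]
    by (intro sum_in_bigo q_plus_A_bigo landau_o.big_trans[OF x2_near]) simp
  then show ?thesis by simp
qed

lemma x3_bigo: "x3 \<in> O[F](\<lambda>_. 1)"
proof -
  have "(\<lambda>z. y z + \<kappa>^2) \<in> O[F](\<lambda>_. 1)"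
    by (intro sum_in_bigo landau_o.big_trans[OF y_bigo H2_bound]) simp
  then show ?thesis by (simp add: y_def)
qed

text \<open>Eventually \<open>\<bar>\<rho>\<bar>\<close> is below both \<open>A\<close> and \<open>\<kappa>\<^sup>2\<close>, so neither numerator leaves the right half
  plane. The bound on \<open>q\<close> gives the lower estimate for \<open>\<mu>2\<close>.\<close>

lemma Re_x_pos: "\<forall>\<^sub>F z in F. cmod (q z) \<le> 2 * cmod (x2 z) \<and> Re (x2 z) > 0 \<and> Re (x3 z) > 0"
proof -
  define C where "C = \<kappa>^2 * (A + \<kappa>^2)"
  have C: "C > 0" using A_pos \<kappa>_pos by (simp add: C_def add_pos_pos)
  have "\<forall>\<^sub>F z in F. h z ^ 2 < min (min A \<kappa>) (\<kappa>^2) / C"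
    using h2_small A_pos \<kappa>_pos C by simp
  then show ?thesis using \<rho>_bound denom_ge x_mult_denom Re_q unfolding C_def[symmetric]
  proof eventually_elim
    case (elim z)
    define D where "D = 2 * (1 - A * h z ^ 2 / 4)"
    have D: "1 \<le> D" "D \<le> 2" using elim A_pos by (simp_all add: D_def)
    have small: "C * h z ^ 2 < A" "C * h z ^ 2 < \<kappa>^2" using elim(1) C by (simp_all add: field_simps)
    have Re: "- A < Re (\<rho> z)" "Re (\<rho> z) < \<kappa>^2"
      using small elim(2) abs_Re_le_cmod[of "\<rho> z"] by linarith+
    have m: "of_real D * x2 z = 2 * (q z + A) + \<rho> z" "of_real D * x3 z = 2 * \<kappa>^2 - \<rho> z"
      using elim(4) by (simp_all add: D_def)
    have "D * Re (x2 z) = 2 * (Re (q z) + A) + Re (\<rho> z)" "D * Re (x3 z) = 2 * \<kappa>^2 - Re (\<rho> z)"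
      using arg_cong[OF m(1), of Re] arg_cong[OF m(2), of Re] by (simp_all flip: of_real_power)
    moreover have "0 \<le> \<kappa>^2" by simp
    then have "2 * Re (q z) + 2 * A + Re (\<rho> z) > 0" using Re(1) elim(5) A_pos by linarith
    then have "2 * (Re (q z) + A) + Re (\<rho> z) > 0" by (simp add: distrib_left)
    moreover have "2 * \<kappa>^2 - Re (\<rho> z) > 0" using Re(2) \<open>0 \<le> \<kappa>^2\<close> by linarith
    ultimately have "D * Re (x2 z) > 0" "D * Re (x3 z) > 0" by simp_all
    then have pos: "Re (x2 z) > 0" "Re (x3 z) > 0" using D by (simp_all add: zero_less_mult_iff)
    have Rq: "Re (q z) \<ge> 0" using elim(5) zero_le_power2[of \<kappa>] by linarith
    have "cmod (q z) \<le> cmod (q z + A)"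
      using Rq A_pos by (simp add: cmod_def power_mono)
    moreover have "A \<le> cmod (q z + A)"
      using complex_Re_le_cmod[of "q z + A"] Rq by simp
    moreover have "D * cmod (x2 z) = cmod (2 * (q z + A) + \<rho> z)"
      using arg_cong[OF m(1), of cmod] D by (simp add: norm_mult)
    moreover have "cmod (2 * (q z + A)) \<le> cmod (2 * (q z + A) + \<rho> z) + cmod (\<rho> z)"
      by (metis norm_triangle_ineq4 add_diff_cancel_right')
    then have "2 * cmod (q z + A) \<le> cmod (2 * (q z + A) + \<rho> z) + cmod (\<rho> z)"
      by (simp only: norm_mult norm_numeral)
    moreover have "D * cmod (x2 z) \<le> 2 * cmod (x2 z)" using D by (intro mult_right_mono) simp_all
    ultimately have "cmod (q z) \<le> 2 * cmod (x2 z)"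
      using small elim(2) by linarith
    then show ?case using pos by simp
  qed
qed

lemma central_rate_bigo:
  assumes "x \<in> O[F](q)"
  shows "(\<lambda>z. central_rate (h z) (x z)) \<in> O[F](S)"
proof -
  have "(\<lambda>z. x z * (H z ^ 2 * x z)) \<in> O[F](\<lambda>z. q z * 1)"
    by (intro landau_o.big.mult assms landau_o.big_trans[OF landau_o.big.mult_left[OF assms] H2q_bound])
  then have "(\<lambda>z. x z + (H z ^ 2 * x z ^ 2) / 4) \<in> O[F](q)"
    by (intro sum_in_bigo assms) (simp add: power2_eq_square mult_ac)
  then obtain C where C: "C > 0" "\<forall>\<^sub>F z in F. cmod (x z + (H z ^ 2 * x z ^ 2) / 4) \<le> C * cmod (q z)"
    by (elim landau_o.bigE) auto
  show ?thesis
  proof (rule bigoI[where c = "sqrt C"])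
    show "\<forall>\<^sub>F z in F. cmod (central_rate (h z) (x z)) \<le> sqrt C * cmod (S z)"
      using C(2)
    proof eventually_elim
      case (elim z)
      from real_sqrt_le_mono[OF elim] show ?case
        by (simp add: central_rate_def S_def real_sqrt_mult)
    qed
  qed
qed

lemma forward_rate_bigo:
  assumes "x \<in> O[F](q)"
  shows "(\<lambda>z. forward_rate (h z) (x z)) \<in> O[F](S)"
proof -
  have "(\<lambda>z. H z * x z) \<in> O[F](\<lambda>z. H z * q z)"
    by (intro landau_o.big.mult_left assms)
  also have "(\<lambda>z. H z * q z) = (\<lambda>z. H z * S z * S z)" by (simp add: S2 mult.assoc)
  also have "\<dots> \<in> O[F](S)" using landau_o.big.mult[OF HS_bound landau_o.big_refl[of S]] by simp
  finally show ?thesis unfolding forward_rate_def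
    by (intro sum_in_bigo central_rate_bigo assms) simp_all
qed

lemma \<mu>1_bigo: "\<mu>1 \<in> O[F](S)" and p1_bigo: "p1 \<in> O[F](S)"
  and \<mu>2_bigo: "\<mu>2 \<in> O[F](S)" and p2_bigo: "p2 \<in> O[F](S)"
  using central_rate_bigo[of q] central_rate_bigo[OF x2_bigo] forward_rate_bigo[of q] forward_rate_bigo[OF x2_bigo]
  by (simp_all add: \<mu>1_def[abs_def] \<mu>2_def[abs_def] p1_def[abs_def] p2_def[abs_def])

lemma S_le_\<mu>2: "S \<in> O[F](\<mu>2)"
proof (rule bigoI[where c = "sqrt 2"])
  show "\<forall>\<^sub>F z in F. cmod (S z) \<le> sqrt 2 * cmod (\<mu>2 z)"
    using Re_x_pos
  proof eventually_elim
    case (elim z)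
    then have "cmod (q z) \<le> 2 * (cmod (\<mu>2 z))^2"
      using norm_le_central_rate_sq[of "x2 z" "h z"] by (simp add: \<mu>2_def)
    from real_sqrt_le_mono[OF this] show ?case
      by (simp add: S_def real_sqrt_mult)
  qed
qed

lemma \<theta>_mult: "\<theta> z * (\<mu>1 z + \<kappa>) = \<tau> z"
proof -
  have "\<mu>1 z ^ 2 = q z + H z ^ 2 * q z ^ 2 / 4" by (simp add: \<mu>1_def central_rate_def)
  then show ?thesis by (simp add: \<theta>_def \<tau>_def q_def power2_eq_square algebra_simps)
qed

text \<open>No cancellation occurs in \<open>\<mu>\<^sub>1 + \<kappa>\<close>, as \<open>\<kappa> > 0\<close> and \<open>Re \<mu>\<^sub>1 \<ge> 0\<close>, so its modulus is at least
  \<open>\<bar>\<mu>\<^sub>1\<bar> \<ge> \<bar>S\<bar>\<close>.\<close>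

lemma \<theta>S_bigo: "(\<lambda>z. \<theta> z * S z) \<in> O[F](\<tau>)"
proof (rule bigoI[where c = 1])
  show "\<forall>\<^sub>F z in F. cmod (\<theta> z * S z) \<le> 1 * cmod (\<tau> z)"
    using Re_q
  proof eventually_elim
    case (elim z)
    then have "Re (q z) \<ge> 0" using zero_le_power2[of \<kappa>] by linarith
    then have "sqrt (cmod (q z)) \<le> cmod (\<mu>1 z)"
      using norm_le_central_rate_sq[of "q z" "h z"] by (simp add: \<mu>1_def real_le_lsqrt)
    moreover have "cmod (\<mu>1 z) \<le> cmod (\<mu>1 z + \<kappa>)"
      using Re_csqrt[of "q z + H z ^ 2 * q z ^ 2 / 4"] \<kappa>_pos
      by (simp add: cmod_def power_mono \<mu>1_def central_rate_def del: csqrt.simps)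
    ultimately have "cmod (S z) \<le> cmod (\<mu>1 z + \<kappa>)" by (simp add: S_def)
    then show ?case unfolding \<theta>_mult[symmetric] by (simp add: norm_mult mult_left_mono)
  qed
qed

lemma \<theta>_bigo: "\<theta> \<in> O[F](\<tau>)"
  by (rule landau_o.big_trans[OF landau_o.big_mult_1[OF landau_o.big_refl one_le_S] \<theta>S_bigo])

lemma \<tau>_bigo: "\<tau> \<in> O[F](\<lambda>z. \<theta> z * S z)"
proof -
  have "(\<lambda>z. \<mu>1 z + \<kappa>) \<in> O[F](S)"
    using landau_o.big.cmult_in_iff[of "of_real \<kappa>" "\<lambda>_. 1" F S] one_le_S \<kappa>_pos
    by (intro sum_in_bigo \<mu>1_bigo) auto
  then have "(\<lambda>z. \<theta> z * (\<mu>1 z + \<kappa>)) \<in> O[F](\<lambda>z. \<theta> z * S z)" by (rule landau_o.big.mult_left)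
  then show ?thesis by (simp add: \<theta>_mult)
qed

section \<open>Leading term of the determinant\<close>

lemma const_bigo_1: "(\<lambda>_. k) \<in> O[F](\<lambda>_. 1 :: complex)" by simp

lemma \<sigma>_plus_A_ge: "(\<lambda>_. 1) \<in> O[F](\<lambda>z. \<sigma> z + A)"
proof (rule bigoI[where c = "1 / A"])
  show "\<forall>\<^sub>F z in F. cmod 1 \<le> 1 / A * cmod (\<sigma> z + A)"
    using Re_\<sigma>
  proof eventually_elim
    case (elim z)
    then have "A \<le> cmod (\<sigma> z + A)" using complex_Re_le_cmod[of "\<sigma> z + A"] by simp
    then show ?case using A_pos by (simp add: field_simps)
  qed
qed

lemma q_le_\<sigma>_plus_A: "q \<in> O[F](\<lambda>z. \<sigma> z + A)"
proof -
  have "(\<lambda>z. (\<sigma> z + A) + (\<kappa>^2 - A)) \<in> O[F](\<lambda>z. \<sigma> z + A)"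
    by (intro sum_in_bigo landau_o.big_trans[OF const_bigo_1 \<sigma>_plus_A_ge] landau_o.big_refl)
  then show ?thesis by (simp add: q_def[abs_def] algebra_simps)
qed

text \<open>The three factors on the right are bounded below by multiples of \<open>q\<close>, \<open>S\<close> and \<open>\<tau>/S\<close>.\<close>

lemma q\<tau>_le_main: "(\<lambda>z. q z * \<tau> z) \<in> O[F](\<lambda>z. (\<sigma> z + A) * \<mu>2 z * \<theta> z)"
proof -
  have "\<tau> \<in> O[F](\<lambda>z. \<theta> z * \<mu>2 z)"
    by (rule landau_o.big_trans[OF \<tau>_bigo landau_o.big.mult_left[OF S_le_\<mu>2]])
  from landau_o.big.mult[OF q_le_\<sigma>_plus_A this] show ?thesis
    by (rule bigo_rearrange) (simp_all only: mult_ac)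
qed

text \<open>This difference is \<open>x\<^sub>1 - x\<^sub>3\<close>. It appears as a factor in the estimates of \<open>\<phi>\<close> and of
  \<open>h\<^sup>2 q\<^sup>2/4 + y\<close> and supplies their factor \<open>\<tau>\<close>.\<close>

lemma \<sigma>_minus_y_bigo: "(\<lambda>z. \<sigma> z - y z) \<in> O[F](\<tau>)"
  by (intro sum_in_bigo \<sigma>_le_\<tau> landau_o.big_trans[OF y_bigo H2_le_\<tau>])

lemma y_quadratic: "\<forall>\<^sub>F z in F. y z * (y z - \<sigma> z - A) = A * H z ^ 2 * x3 z ^ 2 / 4"
  using denom_ge
proof eventually_elim
  case (elim z)
  then have "A * h z ^ 2 \<noteq> 4" by auto
  from x_minus_quadratic[OF this] show ?case by (simp add: y_def x3_def)
qed

text \<open>The right side is \<open>\<bar>\<mu>\<^sub>3\<^sup>2 - \<kappa>\<^sup>2\<bar>/\<kappa>\<close>, and \<open>\<bar>\<mu>\<^sub>3 + \<kappa>\<bar> \<ge> \<kappa>\<close>.\<close>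

lemma \<phi>_norm_le: "cmod (\<phi> z) \<le> cmod (y z + H z ^ 2 * x3 z ^ 2 / 4) / \<kappa>"
proof -
  have "\<mu>3 z ^ 2 = x3 z + H z ^ 2 * x3 z ^ 2 / 4" by (simp add: \<mu>3_def central_rate_def)
  then have eq: "\<phi> z * (\<mu>3 z + \<kappa>) = y z + H z ^ 2 * x3 z ^ 2 / 4"
    by (simp add: \<phi>_def y_def power2_eq_square algebra_simps)
  have "\<kappa> \<le> cmod (\<mu>3 z + \<kappa>)"
    using Re_csqrt[of "x3 z + H z ^ 2 * x3 z ^ 2 / 4"] complex_Re_le_cmod[of "\<mu>3 z + \<kappa>"]
    by (simp add: \<mu>3_def central_rate_def del: csqrt.simps)
  then have "cmod (\<phi> z) * \<kappa> \<le> cmod (\<phi> z) * cmod (\<mu>3 z + \<kappa>)" by (intro mult_left_mono) simp_all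
  then have "cmod (\<phi> z) * \<kappa> \<le> cmod (y z + H z ^ 2 * x3 z ^ 2 / 4)"
    unfolding norm_mult[symmetric] eq .
  then show ?thesis using \<kappa>_pos by (simp add: pos_le_divide_eq)
qed

lemma \<phi>_bigo_aux: "\<phi> \<in> O[F](\<lambda>z. y z + H z ^ 2 * x3 z ^ 2 / 4)"
  using \<phi>_norm_le by (intro bigoI[where c = "1 / \<kappa>"] always_eventually) simp

lemma x3_sq_bigo: "(\<lambda>z. x3 z ^ 2) \<in> O[F](\<lambda>_. 1)"
  using landau_o.big.mult[OF x3_bigo x3_bigo] by (simp add: power2_eq_square)

lemma \<phi>_bigo_H2: "\<phi> \<in> O[F](\<lambda>z. H z ^ 2)"
  using landau_o.big.mult[OF landau_o.big_refl[of "\<lambda>z. H z ^ 2"] x3_sq_bigo]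
  by (intro landau_o.big_trans[OF \<phi>_bigo_aux] sum_in_bigo y_bigo) simp_all

text \<open>By the quadratic equation, \<open>A (\<mu>\<^sub>3\<^sup>2 - \<kappa>\<^sup>2) = y (y - \<sigma>)\<close>: the two contributions of order \<open>h\<^sup>2\<close>
  to \<open>\<mu>\<^sub>3\<^sup>2\<close> cancel up to a term that carries a factor \<open>\<tau>\<close>.\<close>

lemma \<phi>_bigo: "\<phi> \<in> O[F](\<lambda>z. H z ^ 2 * \<tau> z)"
proof -
  have "(\<lambda>z. - (1 / A) * (y z * (\<sigma> z - y z))) \<in> O[F](\<lambda>z. H z ^ 2 * \<tau> z)"
    using landau_o.big.mult[OF const_bigo_1 landau_o.big.mult[OF y_bigo \<sigma>_minus_y_bigo]]
    by (simp only: mult_1_left of_real_1)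
  also have "?this \<longleftrightarrow> (\<lambda>z. y z + H z ^ 2 * x3 z ^ 2 / 4) \<in> O[F](\<lambda>z. H z ^ 2 * \<tau> z)"
  proof (rule landau_o.big.in_cong)
    show "\<forall>\<^sub>F z in F. - (1 / A) * (y z * (\<sigma> z - y z)) = y z + H z ^ 2 * x3 z ^ 2 / 4"
      using y_quadratic
    proof eventually_elim
      case (elim z)
      have "y z * (\<sigma> z - y z) = - A * (y z + H z ^ 2 * x3 z ^ 2 / 4)"
      proof -
        have "y z * (\<sigma> z - y z) = - (y z * (y z - \<sigma> z - A)) - A * y z" by (simp add: algebra_simps)
        then show ?thesis unfolding elim by (simp add: algebra_simps)
      qed
      then show ?case using A_pos by simp
    qed
  qed
  finally show ?thesis by (rule landau_o.big_trans[OF \<phi>_bigo_aux])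
qed

lemma q_nonzero: "\<forall>\<^sub>F z in F. q z \<noteq> 0"
  using Re_q
proof eventually_elim
  case (elim z)
  then have "Re (q z) \<noteq> 0" using zero_le_power2[of \<kappa>] by linarith
  then show ?case by auto
qed

lemma H_small: "H \<in> o[F](\<lambda>_. 1)"
proof -
  have "((\<lambda>z. H z) \<longlongrightarrow> of_real 0) F" by (intro tendsto_intros h_lim)
  then show ?thesis by (intro smalloI_tendsto) simp_all
qed

text \<open>Multiplying by \<open>\<sigma> + A - y\<close>, which is comparable to \<open>\<sigma> + A\<close>, and using the quadratic
  equation for \<open>x\<^sub>3\<close> turns the sum into \<open>(h\<^sup>2/4) (q\<^sup>2 (\<sigma> - y) + A (q\<^sup>2 - x\<^sub>3\<^sup>2))\<close>. As
  \<open>q - x\<^sub>3 = \<sigma> - y\<close>, both parts contain the factor \<open>\<sigma> - y\<close>, which is \<open>O(\<tau>)\<close>.\<close>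

lemma y_cancellation: "(\<lambda>z. H z ^ 2 * q z ^ 2 / 4 + y z) \<in> O[F](\<lambda>z. H z ^ 2 * \<tau> z * q z)"
proof -
  let ?G = "\<lambda>z. H z ^ 2 * q z ^ 2 / 4 + y z" and ?d = "\<lambda>z. \<sigma> z + A - y z"
  have "y \<in> o[F](\<lambda>z. 1)"
    using landau_o.small_mult[OF H_small H_small] by (intro landau_o.big_small_trans[OF y_bigo]) (simp add: power2_eq_square)
  then have "y \<in> o[F](\<lambda>z. \<sigma> z + A)" by (rule landau_o.small_big_trans[OF _ \<sigma>_plus_A_ge])
  then have "q \<in> O[F](?d)" using q_le_\<sigma>_plus_A by (simp add: landau_o.big.diff_absorb2)
  then have "(\<lambda>z. ?G z * q z) \<in> O[F](\<lambda>z. ?G z * ?d z)" by (rule landau_o.big.mult_left)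
  also have "?this \<longleftrightarrow> (\<lambda>z. ?G z * q z) \<in> O[F](\<lambda>z. H z ^ 2 * (\<sigma> z - y z) * (q z * q z + A * (q z + x3 z)))"
  proof -
    have "\<forall>\<^sub>F z in F. ?G z * ?d z = (1 / 4) * (H z ^ 2 * (\<sigma> z - y z) * (q z * q z + A * (q z + x3 z)))"
      using y_quadratic
    proof eventually_elim
      case (elim z)
      have "x3 z = y z + \<kappa>^2" "\<sigma> z = q z - \<kappa>^2" by (simp_all add: y_def q_def)
      note subs = this
      have "?G z * ?d z = H z ^ 2 * q z ^ 2 / 4 * ?d z - y z * (y z - \<sigma> z - A)"
        by (simp add: algebra_simps)
      also have "\<dots> = (1 / 4) * (H z ^ 2 * (\<sigma> z - y z) * (q z * q z + A * (q z + x3 z)))"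
        unfolding elim unfolding subs by (simp add: power2_eq_square field_simps)
      finally show ?case .
    qed
    from landau_o.big.cong[OF this] show ?thesis by simp
  qed
  also have "(\<lambda>z. H z ^ 2 * (\<sigma> z - y z) * (q z * q z + A * (q z + x3 z))) \<in> O[F](\<lambda>z. H z ^ 2 * \<tau> z * (q z * q z))"
  proof -
    have "(\<lambda>z. q z + x3 z) \<in> O[F](q)"
      by (intro sum_in_bigo landau_o.big_refl landau_o.big_trans[OF x3_bigo one_le_q])
    from landau_o.big_mult_1[OF this one_le_q]
    have "(\<lambda>z. q z * q z + A * (q z + x3 z)) \<in> O[F](\<lambda>z. q z * q z)"
      by (intro sum_in_bigo) simp_all
    then show ?thesis
      by (intro landau_o.big.mult[OF landau_o.big.mult_left[OF \<sigma>_minus_y_bigo]])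
  qed
  finally show ?thesis
    by (rule bigo_cancel_right[OF bigo_rearrange q_nonzero]) (simp_all only: mult_ac)
qed

lemma H_le_HS: "H \<in> O[F](\<lambda>z. H z * S z)"
  by (rule landau_o.big_mult_1[OF landau_o.big_refl one_le_S])

lemma H_le_Hq: "H \<in> O[F](\<lambda>z. H z * q z)"
  by (rule landau_o.big_mult_1[OF landau_o.big_refl one_le_q])

lemma bigo_H2_imp_H: "f \<in> O[F](\<lambda>z. H z ^ 2) \<Longrightarrow> f \<in> O[F](H)"
  by (rule bigo_absorb[where g = H]) (simp_all add: power2_eq_square H_bound)

text \<open>The coefficient of \<open>\<mu>2 - \<kappa>\<close> in \<open>modal_det_expansion_identity\<close>.\<close>

lemma E_bigo:
  "(\<lambda>z. (\<kappa> * ((H z ^ 2 * q z ^ 2 / 4 + y z) - \<theta> z * H z * q z / 2)) - \<kappa>^2 * \<phi> z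
      - (\<sigma> z - y z) * (\<phi> z - H z * y z / 2)) \<in> O[F](\<lambda>z. H z * S z * \<tau> z)"
proof -
  have 1: "(\<lambda>z. H z ^ 2 * q z ^ 2 / 4 + y z) \<in> O[F](\<lambda>z. H z * S z * \<tau> z)"
    by (rule bigo_absorb[OF bigo_rearrange[OF y_cancellation] HS_bound])
      (simp_all only: S2[symmetric] power2_eq_square mult_ac)
  have 2: "(\<lambda>z. \<theta> z * H z * q z) \<in> O[F](\<lambda>z. H z * S z * \<tau> z)"
    by (rule bigo_rearrange[OF landau_o.big.mult[OF \<theta>S_bigo landau_o.big_refl[of "\<lambda>z. H z * S z"]]])
      (simp_all only: S2[symmetric] mult_ac)
  have "(\<lambda>z. H z * (H z * \<tau> z)) \<in> O[F](\<lambda>z. S z * (H z * \<tau> z))"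
    by (intro landau_o.big.mult_right landau_o.big_trans[OF H_bound one_le_S])
  then have 3: "\<phi> \<in> O[F](\<lambda>z. H z * S z * \<tau> z)"
    by (intro landau_o.big_trans[OF \<phi>_bigo]) (rule bigo_rearrange, assumption, simp_all only: power2_eq_square mult_ac)
  have "\<phi> \<in> O[F](H)" by (intro bigo_H2_imp_H \<phi>_bigo_H2)
  moreover have "(\<lambda>z. H z * y z) \<in> O[F](H)"
    using landau_o.big.mult[OF landau_o.big_refl[of H] landau_o.big_trans[OF y_bigo H2_bound]] by simp
  ultimately have "(\<lambda>z. \<phi> z - H z * y z / 2) \<in> O[F](\<lambda>z. H z * S z)"
    by (intro landau_o.big_trans[OF _ H_le_HS] sum_in_bigo) simp_all
  then have 4: "(\<lambda>z. (\<sigma> z - y z) * (\<phi> z - H z * y z / 2)) \<in> O[F](\<lambda>z. H z * S z * \<tau> z)"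
    by (rule bigo_rearrange[OF landau_o.big.mult[OF \<sigma>_minus_y_bigo]]) (simp_all only: mult_ac)
  have "(\<lambda>z. \<theta> z * H z * q z / 2) \<in> O[F](\<lambda>z. H z * S z * \<tau> z)" using 2 by simp
  from sum_in_bigo(2)[OF 1 this] 3 show ?thesis
    by (intro sum_in_bigo 4) (simp_all add: \<kappa>_pos)
qed

text \<open>The bound must contain the factor \<open>\<tau>\<close>, since the leading term is of order \<open>q \<tau>\<close> and \<open>\<tau>\<close> can
  be as small as a multiple of \<open>h\<^sup>2\<close>.\<close>

lemma modal_det_asymptotics:
  "(\<lambda>z. modal_det (h z) \<kappa> (q z) (x2 z) (x3 z) + \<kappa> * ((\<sigma> z + A) * \<mu>2 z * \<theta> z))
     \<in> O[F](\<lambda>z. H z * (q z * \<tau> z))"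
proof -
  let ?M = "\<lambda>z. H z * (q z * \<tau> z)"
  have expand: "modal_det (h z) \<kappa> (q z) (x2 z) (x3 z) + \<kappa> * ((\<sigma> z + A) * \<mu>2 z * \<theta> z) =
      \<kappa> * ((\<mu>2 z - \<kappa>) * ((\<kappa> * ((H z ^ 2 * q z ^ 2 / 4 + y z) - \<theta> z * H z * q z / 2)) - \<kappa>^2 * \<phi> z
        - (\<sigma> z - y z) * (\<phi> z - H z * y z / 2)))
      + (\<theta> z * \<mu>2 z) * (y z * \<kappa> + (y z - q z) * (p3 z - \<kappa>))
      - \<kappa> * (\<theta> z * ((x2 z - q z - A) * p2 z - (A - \<kappa>^2) * (H z * x2 z) / 2))
      - (x2 z - q z - \<kappa>^2) * p2 z * \<phi> z * \<mu>1 z - \<kappa>^2 * (\<mu>1 z * p1 z * \<phi> z)" for z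
  proof -
    have a2: "\<mu>1 z ^ 2 = q z + H z ^ 2 * q z ^ 2 / 4" by (simp add: \<mu>1_def central_rate_def)
    have p: "p1 z = \<mu>1 z - H z * q z / 2" "p2 z = \<mu>2 z - H z * x2 z / 2" "p3 z = \<mu>3 z - H z * x3 z / 2"
      by (simp_all add: p1_def p2_def p3_def \<mu>1_def \<mu>2_def \<mu>3_def forward_rate_def)
    have "\<sigma> z = q z - \<kappa>^2" by (simp add: q_def)
    then show ?thesis
      using modal_det_expansion_identity[OF a2 p, of "of_real \<kappa>" "of_real A"]
      unfolding modal_det_def p1_def p2_def p3_def \<mu>1_def \<mu>2_def \<mu>3_def \<theta>_def \<phi>_def y_def by simp
  qed
  have "(\<lambda>z. \<mu>2 z - \<kappa>) \<in> O[F](S)"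
    by (intro sum_in_bigo \<mu>2_bigo landau_o.big_trans[OF const_bigo_1 one_le_S])
  note E = landau_o.big.mult[OF this E_bigo]
  have T1: "(\<lambda>z. (\<mu>2 z - \<kappa>) * ((\<kappa> * ((H z ^ 2 * q z ^ 2 / 4 + y z) - \<theta> z * H z * q z / 2)) - \<kappa>^2 * \<phi> z
        - (\<sigma> z - y z) * (\<phi> z - H z * y z / 2))) \<in> O[F](?M)"
    by (rule bigo_rearrange[OF E]) (simp_all only: S2[symmetric] mult_ac)
  have \<theta>\<mu>2: "(\<lambda>z. \<theta> z * \<mu>2 z) \<in> O[F](\<tau>)"
    by (rule landau_o.big_trans[OF landau_o.big.mult_left[OF \<mu>2_bigo] \<theta>S_bigo])
  have "(\<lambda>z. \<phi> z - H z * x3 z / 2) \<in> O[F](H)"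
    using landau_o.big.mult[OF landau_o.big_refl[of H] x3_bigo]
    by (intro sum_in_bigo(2)[OF bigo_H2_imp_H[OF \<phi>_bigo_H2]]) simp
  then have p3\<kappa>: "(\<lambda>z. p3 z - \<kappa>) \<in> O[F](H)"
    by (simp add: p3_def[abs_def] \<phi>_def forward_rate_def \<mu>3_def algebra_simps)
  have y1: "y \<in> O[F](\<lambda>_. 1)" by (rule landau_o.big_trans[OF y_bigo H2_bound])
  have "(\<lambda>z. y z - q z) \<in> O[F](q)"
    by (intro sum_in_bigo landau_o.big_refl landau_o.big_trans[OF y1 one_le_q])
  from landau_o.big.mult[OF this p3\<kappa>]
  have "(\<lambda>z. (y z - q z) * (p3 z - \<kappa>)) \<in> O[F](\<lambda>z. H z * q z)"
    by (rule bigo_rearrange) (simp_all only: mult_ac)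
  moreover have "y \<in> O[F](\<lambda>z. H z * q z)"
    by (rule landau_o.big_trans[OF bigo_H2_imp_H[OF y_bigo] H_le_Hq])
  then have "(\<lambda>z. y z * \<kappa>) \<in> O[F](\<lambda>z. H z * q z)" using \<kappa>_pos by simp
  ultimately have "(\<lambda>z. y z * \<kappa> + (y z - q z) * (p3 z - \<kappa>)) \<in> O[F](\<lambda>z. H z * q z)"
    by (intro sum_in_bigo)
  from landau_o.big.mult[OF \<theta>\<mu>2 this]
  have T2: "(\<lambda>z. (\<theta> z * \<mu>2 z) * (y z * \<kappa> + (y z - q z) * (p3 z - \<kappa>))) \<in> O[F](?M)"
    by (rule bigo_rearrange) (simp_all only: mult_ac)
  have x2': "(\<lambda>z. x2 z - q z - A) \<in> O[F](\<lambda>z. H z ^ 2 * q z)"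
    using x2_near by (simp add: algebra_simps)
  have "(\<lambda>z. \<theta> z * ((x2 z - q z - A) * p2 z)) \<in> O[F](\<lambda>z. \<theta> z * (H z ^ 2 * q z * S z))"
    by (intro landau_o.big.mult_left landau_o.big.mult x2' p2_bigo)
  also have "(\<lambda>z. \<theta> z * (H z ^ 2 * q z * S z)) \<in> O[F](\<lambda>z. H z * ?M z)"
    by (rule bigo_rearrange[OF landau_o.big.mult[OF \<theta>S_bigo landau_o.big_refl[of "\<lambda>z. H z ^ 2 * q z"]]])
      (simp_all only: power2_eq_square mult_ac)
  finally have T3a: "(\<lambda>z. \<theta> z * ((x2 z - q z - A) * p2 z)) \<in> O[F](?M)"
    by (rule bigo_absorb[OF _ H_bound])
  have "(\<lambda>z. (\<theta> z * (H z * x2 z))) \<in> O[F](?M)"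
    by (rule bigo_rearrange[OF landau_o.big.mult[OF \<theta>_bigo landau_o.big.mult_left[OF x2_bigo, of H]]])
      (simp_all only: mult_ac)
  then have T3b: "(\<lambda>z. ((A - \<kappa>^2) / 2) * (\<theta> z * (H z * x2 z))) \<in> O[F](?M)"
    by (simp only: cmult_in_bigo_iff simp_thms)
  have T3: "(\<lambda>z. \<theta> z * ((x2 z - q z - A) * p2 z - (A - \<kappa>^2) * (H z * x2 z) / 2)) \<in> O[F](?M)"
    by (rule bigo_rearrange[OF sum_in_bigo(2)[OF T3a T3b]]) (simp_all add: right_diff_distrib)
  have "(\<lambda>z. (x2 z - q z - A) + (A - \<kappa>^2)) \<in> O[F](\<lambda>_. 1)"
    by (intro sum_in_bigo landau_o.big_trans[OF x2' H2q_bound] const_bigo_1)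
  then have "(\<lambda>z. x2 z - q z - \<kappa>^2) \<in> O[F](\<lambda>_. 1)"
    by (rule bigo_rearrange) simp_all
  note T4' = landau_o.big.mult[OF landau_o.big.mult[OF landau_o.big.mult[OF this p2_bigo] \<phi>_bigo] \<mu>1_bigo]
  have T4: "(\<lambda>z. (x2 z - q z - \<kappa>^2) * p2 z * \<phi> z * \<mu>1 z) \<in> O[F](?M)"
    by (rule bigo_absorb[OF bigo_rearrange[OF T4'] H_bound])
      (simp_all only: S2[symmetric] power2_eq_square mult_ac mult_1_left)
  have T5: "(\<lambda>z. \<mu>1 z * p1 z * \<phi> z) \<in> O[F](?M)"
    by (rule bigo_absorb[OF bigo_rearrange[OF landau_o.big.mult[OF landau_o.big.mult[OF \<mu>1_bigo p1_bigo] \<phi>_bigo]] H_bound])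
      (simp_all only: S2[symmetric] power2_eq_square mult_ac)
  show ?thesis
    unfolding expand using T1 T3 T5 \<kappa>_pos by (intro sum_in_bigo T2 T4) simp_all
qed

lemma modal_det_nonzero:
  "\<forall>\<^sub>F z in F. modal_det (h z) \<kappa> (q z) (x2 z) (x3 z) \<noteq> 0"
proof -
  let ?m = "\<lambda>z. (\<sigma> z + A) * \<mu>2 z * \<theta> z"
  have "(\<lambda>z. H z * (q z * \<tau> z)) \<in> o[F](\<lambda>z. 1 * ?m z)"
    by (rule landau_o.small_big_mult[OF H_small q\<tau>_le_main])
  then have "(\<lambda>z. modal_det (h z) \<kappa> (q z) (x2 z) (x3 z) + \<kappa> * ?m z) \<in> o[F](?m)"
    using landau_o.big_small_trans[OF modal_det_asymptotics] by simp
  then have R: "\<forall>\<^sub>F z in F. cmod (modal_det (h z) \<kappa> (q z) (x2 z) (x3 z) + \<kappa> * ?m z) \<le> \<kappa> / 2 * cmod (?m z)"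
    using \<kappa>_pos by (intro landau_o.smallD) simp_all
  obtain C where C: "\<forall>\<^sub>F z in F. cmod (q z * \<tau> z) \<le> C * cmod (?m z)"
    using q\<tau>_le_main by (elim landau_o.bigE)
  show ?thesis using R C \<tau>_lower q_nonzero h_pos
  proof eventually_elim
    case (elim z)
    have "h z ^ 2 * \<kappa>^4 / 4 > 0" using elim(5) \<kappa>_pos by simp
    then have "\<tau> z \<noteq> 0" using elim(3) by auto
    then have "?m z \<noteq> 0" using elim(2,4) by auto
    then have "\<kappa> / 2 * cmod (?m z) < cmod (\<kappa> * ?m z)" using \<kappa>_pos by (simp add: norm_mult)
    then show ?case using elim(1) by auto
  qed
qed

end

section \<open>Local stability\<close>

text \<open>Statements that hold eventually along this filter are those that hold below some threshold
  \<open>h\<^sub>c\<close>, simultaneously for all admissible second components.\<close>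

lemma eventually_spacing_filter_iff:
  fixes V :: "(real \<times> 'b) set"
  shows "eventually P (inf (filtercomap fst (at_right 0)) (principal V)) \<longleftrightarrow>
    (\<exists>b>0. \<forall>h s. 0 < h \<and> h < b \<and> (h, s) \<in> V \<longrightarrow> P (h, s))"
proof
  assume "eventually P (inf (filtercomap fst (at_right 0)) (principal V))"
  then obtain Q where Q: "eventually Q (at_right (0::real))"
    and P: "\<And>z. Q (fst z) \<Longrightarrow> z \<in> V \<Longrightarrow> P z"
    unfolding eventually_inf_principal eventually_filtercomap by auto
  from Q obtain b where "b > 0" "\<And>h. 0 < h \<Longrightarrow> h < b \<Longrightarrow> Q h"
    unfolding eventually_at_right_field by auto
  then show "\<exists>b>0. \<forall>h s. 0 < h \<and> h < b \<and> (h, s) \<in> V \<longrightarrow> P (h, s)"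
    using P by (intro exI[of _ b]) auto
next
  assume "\<exists>b>0. \<forall>h s. 0 < h \<and> h < b \<and> (h, s) \<in> V \<longrightarrow> P (h, s)"
  then obtain b where "b > 0" and P: "\<And>h s. 0 < h \<Longrightarrow> h < b \<Longrightarrow> (h, s) \<in> V \<Longrightarrow> P (h, s)"
    by auto
  have "eventually (\<lambda>h. 0 < h \<and> h < b) (at_right (0::real))"
    unfolding eventually_at_right_field using \<open>b > 0\<close> by auto
  then show "eventually P (inf (filtercomap fst (at_right 0)) (principal V))"
    unfolding eventually_inf_principal eventually_filtercomap
    using P by (intro exI[of _ "\<lambda>h. 0 < h \<and> h < b"]) (auto simp: split_paired_all)
qed

theorem proposition3:
  shows "\<exists>\<epsilon>>0::real. \<forall>(\<nu>::real) (k::int) (C\<^sub>d::real) (h\<^sub>0::real) (\<alpha>::real).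
           \<nu> > 0 \<and> k \<noteq> 0 \<and> C\<^sub>d > 0 \<and> h\<^sub>0 > 0 \<and> \<alpha> = C\<^sub>d / h\<^sub>0^2 \<longrightarrow>
           (\<exists>h\<^sub>c>0::real. \<forall>(h::real) (s::complex).
              0 < h \<and> h < h\<^sub>c \<and> Re s > 0 \<and>
              cmod (of_real h * csqrt (s / of_real \<nu> + of_int k ^ 2)) < \<epsilon> \<longrightarrow>
              det (Zmat \<nu> \<alpha> k s h) \<noteq> 0)"
\<comment> \<open>The square of \<open>1/2\<close> is the bound \<open>1/4\<close> in the resolution condition.\<close>
proof (rule exI[of _ "1 / 2"], intro conjI allI impI)
  fix \<nu> :: real and k :: int and C\<^sub>d h\<^sub>0 \<alpha> :: real
  assume asm: "\<nu> > 0 \<and> k \<noteq> 0 \<and> C\<^sub>d > 0 \<and> h\<^sub>0 > 0 \<and> \<alpha> = C\<^sub>d / h\<^sub>0^2"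
  then have \<nu>: "\<nu> > 0" and \<alpha>: "\<alpha> > 0" by simp_all
  define \<kappa> where "\<kappa> = \<bar>real_of_int k\<bar>"
  define V where "V = {z :: real \<times> complex. Re (snd z) > 0 \<and>
    cmod (of_real (fst z) * csqrt (snd z / of_real \<nu> + of_int k ^ 2)) < 1 / 2}"
  define F where "F = inf (filtercomap fst (at_right (0::real))) (principal V)"
  have evF: "eventually P F \<longleftrightarrow> (\<exists>b>0. \<forall>h s. 0 < h \<and> h < b \<and> (h, s) \<in> V \<longrightarrow> P (h, s))" for P
    unfolding F_def by (rule eventually_spacing_filter_iff)
  interpret shrinking_spacing "\<alpha> / \<nu>" \<kappa> F fst "\<lambda>z. snd z / of_real \<nu>"
  proof
    show "\<alpha> / \<nu> > 0" using \<nu> \<alpha> by simp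
    show "\<kappa> > 0" using asm by (simp add: \<kappa>_def)
    have "filterlim fst (at_right 0) F"
      unfolding F_def by (intro filterlim_mono[OF filterlim_filtercomap order_refl]) simp
    then show "(fst \<longlongrightarrow> 0) F" by (simp add: filterlim_at)
    show "\<forall>\<^sub>F z in F. 0 < fst z" unfolding evF by (intro exI[of _ 1]) simp
    show "\<forall>\<^sub>F z in F. 0 < Re (snd z / of_real \<nu>)"
      unfolding evF using \<nu> by (intro exI[of _ 1]) (simp add: V_def Re_divide_of_real)
    show "\<forall>\<^sub>F z in F. cmod (of_real (fst z) ^ 2 * (snd z / of_real \<nu> + of_real (\<kappa>^2))) \<le> 1 / 4"
      unfolding evF
    proof (intro exI[of _ 1] conjI allI impI)
      fix h :: real and s :: complex
      define r where "r = of_real h * csqrt (s / of_real \<nu> + of_int k ^ 2)"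
      assume "0 < h \<and> h < 1 \<and> (h, s) \<in> V"
      then have "cmod r \<le> 1 / 2" by (simp add: V_def r_def)
      then have "(cmod r)^2 \<le> (1 / 2)^2" by (intro power_mono) simp_all
      then have "cmod (r^2) \<le> 1 / 4" by (simp only: norm_power) (simp add: power_divide)
      moreover have "r^2 = of_real h ^ 2 * (s / of_real \<nu> + of_real (\<kappa>^2))"
        unfolding r_def \<kappa>_def of_real_power of_real_abs_of_int_sq by (simp add: power_mult_distrib)
      ultimately show "cmod (of_real (fst (h, s)) ^ 2 * (snd (h, s) / of_real \<nu> + of_real (\<kappa>^2))) \<le> 1 / 4"
        by (simp only: fst_conv snd_conv)
    qed simp
  qed
  have "\<forall>\<^sub>F z in F. det (Zmat \<nu> \<alpha> k (snd z) (fst z)) \<noteq> 0"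
    using modal_det_nonzero Re_x_pos Re_q h_pos
  proof eventually_elim
    case (elim z)
    have "0 \<le> \<kappa>^2" by simp
    then have "Re (q z) > 0" using elim(3) by linarith
    then have "\<alpha> * det (Zmat \<nu> \<alpha> k (snd z) (fst z)) = \<nu> * modal_det (fst z) \<kappa> (q z) (x2 z) (x3 z)"
      using det_Zmat_eq[OF \<nu> \<alpha> elim(4), where k = k and s = "snd z"] elim(2)
      unfolding q_def x2_def x3_def \<kappa>_def[symmetric] of_real_power by blast
    then show ?case using elim(1) \<nu> by auto
  qed
  then show "\<exists>h\<^sub>c>0. \<forall>h s. 0 < h \<and> h < h\<^sub>c \<and> Re s > 0 \<and>
      cmod (of_real h * csqrt (s / of_real \<nu> + of_int k ^ 2)) < 1 / 2 \<longrightarrow> det (Zmat \<nu> \<alpha> k s h) \<noteq> 0"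
    unfolding evF by (simp add: V_def)
qed simp

end
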